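(* Let $f\in\mathcal F_{\mathrm{Lip}}$. Assume that $f$ can be written as $f=f_{per}+f_{comp}$, where $f_{per},f_{comp}\in\mathcal F_{\mathrm{Lip}}$ satisfy the two following properties: (a) $x\mapsto f_{per}(x,\xi)$ is $Q_1(0)$-periodic for every $\xi\in\mathbb R^d$; (b) there exists $R>0$ such that $f_{comp}(x,\xi)=0$ for every $x\in\mathbb R^N\setminus Q_R(0)$ and every $\xi\in\mathbb R^d$. Then, for every $x\in\mathbb R^N$, $\xi\in\mathbb Q^d$, and $k\in\mathbb N$, the limit $$f^k_{\mathrm{hom}}(\xi):=\lim_{r\to+\infty}\frac{M_c^{1/k}(f,\xi,Q_r(rx))}{r^N}$$ exists and is independent of $x$.
   Context: Fixed throughout: positive integers $N,d,l$ and $p,q\in(1,+\infty)$ with $\frac1p+\frac1q=1$. $\mathbb N=\{1,2,\dots\}$. $Q_\rho(x)$ is the open cube with center $x$, side length $\rho$ and sides parallel to the coordinate axes. Operator: $A^1,\dots,A^N\in\mathbb R^{l\times d}$ are fixed matrices with the constant-rank property: there is $r_0\in\mathbb N$ with $\operatorname{rank}\big(\sum_{i=1}^N A^iw_i\big)=r_0$ for all $w\in\mathbb R^N\setminus\{0\}$. For $u\in L^p_{\mathrm{loc}}(\mathbb R^N;\mathbb R^d)$, $\mathcal Au$ is the distribution $\langle\mathcal Au,\psi\rangle=-\sum_{i=1}^N\int_{\mathbb R^N}(A^iu)\cdot\partial_i\psi\,dx$, $\psi\in C_c^\infty(\mathbb R^N;\mathbb R^l)$. Constants: a locally bounded Borel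 function $g:\mathbb R^d\to\mathbb R$ is $\mathcal A$-quasiconvex if, for a cube $Q\subset\mathbb R^N$ (the notion does not depend on $Q$), $g(\xi)\le\frac1{|Q|}\int_Qg(\xi+w(x))\,dx$ for every $\xi\in\mathbb R^d$ and every $Q$-periodic $w\in C^\infty(\mathbb R^N;\mathbb R^d)$ with $\mathcal Aw=0$ in $\mathbb R^N$ and $\int_Qw\,dx=0$. The wave cone is $\Lambda:=\bigcup_{w\in\mathbb R^N\setminus\{0\}}\ker\big(\sum_{i=1}^NA^iw_i\big)\subset\mathbb R^d$. Constants $c_0\ge1$ and $c_1\ge\hat c_1\ge1$ are fixed, where $\hat c_1$ is a constant such that, in the case $\operatorname{span}(\Lambda)=\mathbb R^d$, every $\mathcal A$-quasiconvex $g:\mathbb R^d\to[0,+\infty)$ with $\frac1{c_0}|\xi|^p-c_0\le g(\xi)\le c_0(1+|\xi|^p)$ for all $\xi$ satisfies $|g(\xi_1)-g(\xi_2)|\le\hat c_1\big(1+\min\{g(\xi_1),g(\xi_2)\}^{\frac{p-1}p}+|\xi_1-\xi_2|^{p-1}\big)|\xi_1-\xi_2|$ for all $\xi_1,\xi_2$ (such a constant exists in that case). Classes of integrands: $\mathcal F$ is the collection of all Carathéodory functions $f:\mathbb R^N\times\mathbb R^d\to[0,+\infty)$ with $\frac1{c_0}|\xi|^p-c_0\le f(x,\xi)\le c_0(1+|\xi|^p)$ for every $x\in\mathbb R^N$ and $\xi\in\mathbb R^d$. $\mathcal F_{\mathrm{Lip}}$ is the set of $f\in\mathcal F$ with $|f(x,\xi_1)-f(x,\xi_2)|\le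 c_1\big(1+\min\{f(x,\xi_1),f(x,\xi_2)\}^{\frac{p-1}p}+|\xi_1-\xi_2|^{p-1}\big)|\xi_1-\xi_2|$ for every $x\in\mathbb R^N$ and $\xi_1,\xi_2\in\mathbb R^d$. Relaxed auxiliary infima: for $D\subset\mathbb R^N$ bounded open and $\eta>0$, $\mathcal V^\eta(D)$ is the set of $V\in L^p(D;\mathbb R^{l\times N})$ with $\|V\|^p_{L^p(D;\mathbb R^{l\times N})}<\eta|D|$, and $\mathcal U^\eta_c(D)$ is the set of $u\in L^p(D;\mathbb R^d)$ with $\operatorname{supp}u\subset\subset D$, $\int_Du\,dx=0$, such that for some $V\in\mathcal V^\eta(D)$ one has $-\sum_{i=1}^N\int_D(A^iu)\cdot\partial_i\psi\,dx=\int_DV\cdot\nabla\psi\,dx$ for every $\psi\in W^{1,q}(D;\mathbb R^l)$ (test functions not required to vanish on $\partial D$; $\cdot$ between matrices is the Euclidean scalar product). For $f\in\mathcal F$ and $\xi\in\mathbb R^d$, $M_c^\eta(f,\xi,D):=\inf\{\int_Df(x,\xi+u(x))\,dx:u\in\mathcal U_c^\eta(D)\}$.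
   Formalization: As printed, f_comp in F_Lip contradicts (b), since the lower growth bound forces f_comp > 0 for large |ξ| at every x; the formal theorem requires of f_comp all conditions of F_Lip except that lower bound. *)

theory Defs
  imports "HOL-Analysis.Analysis"
begin

text \<open>
  Dimensions are rendered as finite index types: N = CARD('n), d = CARD('d), l = CARD('l).
  An l-by-d matrix has type \<open>real^'d^'l\<close>, an l-by-N matrix has type \<open>real^'n^'l\<close>; on these nested
  vector types \<open>norm\<close> and \<open>\<bullet>\<close> are the Euclidean (Frobenius) norm and scalar product.
\<close>

section \<open>Cubes, periodicity, smooth functions\<close>

definition cube :: "real \<Rightarrow> real^'n \<Rightarrow> (real^'n) set" where
  "cube \<rho> x = {y. \<forall>i. \<bar>y $ i - x $ i\<bar> < \<rho> / 2}"

text \<open>Periodicity with respect to any cube of side length \<open>\<rho>\<close>.\<close>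

definition cube_periodic :: "real \<Rightarrow> (real^'n \<Rightarrow> 'b) \<Rightarrow> bool" where
  "cube_periodic \<rho> h \<longleftrightarrow> (\<forall>x i. h (x + \<rho> *\<^sub>R axis i 1) = h x)"

text \<open>Class \<open>C\<^sup>k\<close>, by recursion on directional derivatives.\<close>

fun Ck :: "nat \<Rightarrow> ('a::real_normed_vector \<Rightarrow> 'b::real_normed_vector) \<Rightarrow> bool" where
  "Ck 0 h \<longleftrightarrow> continuous_on UNIV h"
| "Ck (Suc k) h \<longleftrightarrow> (\<forall>x. h differentiable (at x)) \<and>
     (\<forall>v. Ck k (\<lambda>x. frechet_derivative h (at x) v))"

definition smooth :: "('a::real_normed_vector \<Rightarrow> 'b::real_normed_vector) \<Rightarrow> bool" where
  "smooth h \<longleftrightarrow> (\<forall>k. Ck k h)"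

definition partial_deriv :: "'n \<Rightarrow> (real^'n \<Rightarrow> 'b::real_normed_vector) \<Rightarrow> real^'n \<Rightarrow> 'b" where
  "partial_deriv i h x = frechet_derivative h (at x) (axis i 1)"

definition compactly_inside :: "'a::topological_space set \<Rightarrow> 'a set \<Rightarrow> bool" where
  "compactly_inside S D \<longleftrightarrow> compact (closure S) \<and> closure S \<subseteq> D"

definition test_fun ::
  "(real^'n) set \<Rightarrow> (real^'n \<Rightarrow> 'b::real_normed_vector) \<Rightarrow> bool" where
  "test_fun D \<phi> \<longleftrightarrow> smooth \<phi> \<and> compactly_inside {x. \<phi> x \<noteq> 0} D"

section \<open>Lebesgue and Sobolev functions\<close>

text \<open>Elements of \<open>L\<^sup>p(D)\<close> are represented by functions on the whole space; only their values on
  \<open>D\<close> matter.\<close>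

definition Lp :: "real \<Rightarrow> (real^'n) set \<Rightarrow> (real^'n \<Rightarrow> 'b::euclidean_space) \<Rightarrow> bool" where
  "Lp p D u \<longleftrightarrow> set_borel_measurable lebesgue D u \<and>
     set_integrable lebesgue D (\<lambda>x. norm (u x) powr p)"

text \<open>The support of a measurable function on \<open>D\<close>: the complement in \<open>D\<close> of the largest relatively
  open set on which it vanishes almost everywhere.\<close>

definition ess_supp :: "(real^'n) set \<Rightarrow> (real^'n \<Rightarrow> 'b::zero) \<Rightarrow> (real^'n) set" where
  "ess_supp D u = D - \<Union>{U. open U \<and> (AE x in lebesgue. x \<in> D \<inter> U \<longrightarrow> u x = 0)}"

text \<open>\<open>W1q q D \<psi> G\<close>: \<open>\<psi>\<close> belongs to \<open>W\<^sup>1\<^sup>,\<^sup>q(D; \<real>\<^sup>l)\<close> and has weak gradient \<open>G\<close>, where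
  \<open>G x $ j $ i\<close> is the i-th partial derivative of the j-th component.\<close>

definition W1q ::
  "real \<Rightarrow> (real^'n) set \<Rightarrow> (real^'n \<Rightarrow> real^'l) \<Rightarrow> (real^'n \<Rightarrow> real^'n^'l) \<Rightarrow> bool" where
  "W1q q D \<psi> G \<longleftrightarrow> Lp q D \<psi> \<and> Lp q D G \<and>
     (\<forall>\<phi> :: real^'n \<Rightarrow> real. test_fun D \<phi> \<longrightarrow>
       (\<forall>i. (LINT x:D|lebesgue. partial_deriv i \<phi> x *\<^sub>R \<psi> x) =
            - (LINT x:D|lebesgue. \<phi> x *\<^sub>R column i (G x))))"

section \<open>The operator\<close>

definition symbol :: "('n \<Rightarrow> real^'d^'l) \<Rightarrow> real^'n \<Rightarrow> real^'d^'l" where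
  "symbol A w = (\<Sum>i\<in>UNIV. (w $ i) *\<^sub>R A i)"

definition constant_rank :: "('n::finite \<Rightarrow> real^'d^'l) \<Rightarrow> bool" where
  "constant_rank A \<longleftrightarrow> (\<exists>r0\<ge>1. \<forall>w. w \<noteq> 0 \<longrightarrow> rank (symbol A w) = r0)"

definition wave_cone :: "('n::finite \<Rightarrow> real^'d^'l) \<Rightarrow> (real^'d) set" where
  "wave_cone A = (\<Union>w\<in>UNIV - {0}. {\<xi>. symbol A w *v \<xi> = 0})"

definition A_dist ::
  "('n \<Rightarrow> real^'d^'l) \<Rightarrow> (real^'n \<Rightarrow> real^'d) \<Rightarrow> (real^'n \<Rightarrow> real^'l) \<Rightarrow> real" where
  "A_dist A u \<psi> = - (\<Sum>i\<in>UNIV. LINT x|lebesgue. (A i *v u x) \<bullet> partial_deriv i \<psi> x)"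

definition A_free :: "('n::finite \<Rightarrow> real^'d^'l) \<Rightarrow> (real^'n \<Rightarrow> real^'d) \<Rightarrow> bool" where
  "A_free A u \<longleftrightarrow> (\<forall>\<psi> :: real^'n \<Rightarrow> real^'l. test_fun UNIV \<psi> \<longrightarrow> A_dist A u \<psi> = 0)"

text \<open>The notion does not depend on the cube; the unit cube is used.\<close>

definition A_quasiconvex :: "('n::finite \<Rightarrow> real^'d^'l) \<Rightarrow> (real^'d \<Rightarrow> real) \<Rightarrow> bool" where
  "A_quasiconvex A g \<longleftrightarrow>
     g \<in> borel_measurable borel \<and> (\<forall>S. bounded S \<longrightarrow> bounded (g ` S)) \<and>
     (\<forall>\<xi>. \<forall>w :: real^'n \<Rightarrow> real^'d.
        smooth w \<and> cube_periodic 1 w \<and> A_free A w \<and> (LINT x:cube 1 0|lebesgue. w x) = 0 \<longrightarrow>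
        g \<xi> \<le> (LINT x:cube 1 0|lebesgue. g (\<xi> + w x)) / measure lebesgue (cube 1 (0 :: real^'n)))"

section \<open>Integrands\<close>

definition p_growth :: "real \<Rightarrow> real \<Rightarrow> (real^'d \<Rightarrow> real) \<Rightarrow> bool" where
  "p_growth c0 p g \<longleftrightarrow>
     (\<forall>\<xi>. (1 / c0) * norm \<xi> powr p - c0 \<le> g \<xi> \<and> g \<xi> \<le> c0 * (1 + norm \<xi> powr p))"

definition p_lipschitz :: "real \<Rightarrow> real \<Rightarrow> (real^'d \<Rightarrow> real) \<Rightarrow> bool" where
  "p_lipschitz c p g \<longleftrightarrow>
     (\<forall>\<xi>1 \<xi>2. \<bar>g \<xi>1 - g \<xi>2\<bar> \<le>
        c * (1 + min (g \<xi>1) (g \<xi>2) powr ((p - 1) / p) + norm (\<xi>1 - \<xi>2) powr (p - 1))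
          * norm (\<xi>1 - \<xi>2))"

definition caratheodory :: "(real^'n \<Rightarrow> real^'d \<Rightarrow> real) \<Rightarrow> bool" where
  "caratheodory f \<longleftrightarrow> (\<forall>\<xi>. (\<lambda>x. f x \<xi>) \<in> borel_measurable lebesgue) \<and>
     (AE x in lebesgue. continuous_on UNIV (f x))"

definition integrands :: "real \<Rightarrow> real \<Rightarrow> (real^'n \<Rightarrow> real^'d \<Rightarrow> real) set" where
  "integrands c0 p =
     {f. caratheodory f \<and> (\<forall>x \<xi>. 0 \<le> f x \<xi>) \<and> (\<forall>x. p_growth c0 p (f x))}"

definition integrands_Lip ::
  "real \<Rightarrow> real \<Rightarrow> real \<Rightarrow> (real^'n \<Rightarrow> real^'d \<Rightarrow> real) set" where
  "integrands_Lip c0 c1 p = {f \<in> integrands c0 p. \<forall>x. p_lipschitz c1 p (f x)}"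

text \<open>
  All requirements of \<open>integrands_Lip\<close> except the lower (coercivity) bound. This is the class for
  the compactly supported perturbation: a member of \<open>integrands_Lip\<close> cannot vanish outside a cube
  (lemma \<open>integrands_Lip_not_compact_support\<close>), so requiring \<open>integrands_Lip\<close> there would make the
  hypotheses contradictory. By \<open>integrands_Lip_subset\<close> this requirement is weaker.
\<close>

definition integrands_Lip_upper ::
  "real \<Rightarrow> real \<Rightarrow> real \<Rightarrow> (real^'n \<Rightarrow> real^'d \<Rightarrow> real) set" where
  "integrands_Lip_upper c0 c1 p =
     {f. caratheodory f \<and> (\<forall>x \<xi>. 0 \<le> f x \<xi>) \<and>
         (\<forall>x \<xi>. f x \<xi> \<le> c0 * (1 + norm \<xi> powr p)) \<and> (\<forall>x. p_lipschitz c1 p (f x))}"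

lemma integrands_Lip_subset: "integrands_Lip c0 c1 p \<subseteq> integrands_Lip_upper c0 c1 p"
  by (auto simp: integrands_Lip_def integrands_def integrands_Lip_upper_def p_growth_def)

lemma integrands_Lip_not_compact_support:
  fixes f :: "real^'n \<Rightarrow> real^'d \<Rightarrow> real"
  assumes "1 \<le> c0" "1 < p" "f \<in> integrands_Lip c0 c1 p"
  shows "\<not> (\<exists>R>0. \<forall>x \<xi>. x \<notin> cube R 0 \<longrightarrow> f x \<xi> = 0)"
proof
  assume "\<exists>R>0. \<forall>x \<xi>. x \<notin> cube R 0 \<longrightarrow> f x \<xi> = 0"
  then obtain R where R: "R > 0" "\<And>x \<xi>. x \<notin> cube R 0 \<Longrightarrow> f x \<xi> = 0" by blast
  define x :: "real^'n" where "x = (\<chi> i. R)"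
  define t where "t = c0 * c0 + 1"
  define \<xi> :: "real^'d" where "\<xi> = t *\<^sub>R axis undefined 1"
  have "x \<notin> cube R 0" using R(1) by (auto simp: cube_def x_def)
  then have z: "f x \<xi> = 0" by (rule R(2))
  have t1: "t \<ge> 1" by (simp add: t_def)
  have n: "norm \<xi> = t" using t1 by (simp add: \<xi>_def norm_axis_1)
  have "(1 / c0) * norm \<xi> powr p - c0 \<le> f x \<xi>"
    using assms(3) by (auto simp: integrands_Lip_def integrands_def p_growth_def)
  then have "t powr p \<le> c0 * c0" using z n assms(1) by (simp add: field_simps)
  moreover have "t powr 1 \<le> t powr p" using t1 assms(2) by (intro powr_mono) auto
  ultimately show False using t1 by (simp add: t_def)
qed

section \<open>Relaxed auxiliary infima\<close>

definition V_eta :: "real \<Rightarrow> real \<Rightarrow> (real^'n) set \<Rightarrow> (real^'n \<Rightarrow> real^'n^'l) set" where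
  "V_eta p \<eta> D = {V. Lp p D V \<and>
     (LINT x:D|lebesgue. norm (V x) powr p) < \<eta> * measure lebesgue D}"

text \<open>Test functions in \<open>W\<^sup>1\<^sup>,\<^sup>q(D)\<close> need not vanish on the boundary of \<open>D\<close>; the i-th weak partial
  derivative of \<open>\<psi>\<close> is \<open>column i (G x)\<close>.\<close>

definition U_eta_c ::
  "('n::finite \<Rightarrow> real^'d^'l) \<Rightarrow> real \<Rightarrow> real \<Rightarrow> real \<Rightarrow> (real^'n) set \<Rightarrow> (real^'n \<Rightarrow> real^'d) set" where
  "U_eta_c A p q \<eta> D = {u. Lp p D u \<and> compactly_inside (ess_supp D u) D \<and>
     (LINT x:D|lebesgue. u x) = 0 \<and>
     (\<exists>V \<in> V_eta p \<eta> D. \<forall>(\<psi> :: real^'n \<Rightarrow> real^'l) G. W1q q D \<psi> G \<longrightarrow>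
        - (\<Sum>i\<in>UNIV. LINT x:D|lebesgue. (A i *v u x) \<bullet> column i (G x)) =
        (LINT x:D|lebesgue. V x \<bullet> G x))}"

text \<open>For nonempty \<open>D\<close> and \<open>\<eta> > 0\<close> the infimum is over a nonempty set (\<open>u = 0\<close> is admissible)
  bounded below by 0.\<close>

definition M_eta_c ::
  "('n::finite \<Rightarrow> real^'d^'l) \<Rightarrow> real \<Rightarrow> real \<Rightarrow> real \<Rightarrow>
   (real^'n \<Rightarrow> real^'d \<Rightarrow> real) \<Rightarrow> real^'d \<Rightarrow> (real^'n) set \<Rightarrow> real" where
  "M_eta_c A p q \<eta> f \<xi> D = (INF u \<in> U_eta_c A p q \<eta> D. LINT x:D|lebesgue. f x (\<xi> + u x))"

end

theory Submission
  imports Defs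
begin

text \<open>
  Let \<open>u\<close> be a competitor on a cube of side \<open>s\<close>, and let \<open>m \<ge> s\<close> be an integer. Translating \<open>u\<close> by
  vectors of the lattice \<open>m\<int>\<^sup>N\<close> and extending by zero gives a competitor on a cube of side \<open>r\<close>: since
  test functions need not vanish on the boundary, the constraint restricts to each small cube. All
  but a bounded number of the translates contained in the large cube avoid the support of \<open>f_comp\<close>,
  and on those \<open>f = f_per\<close> is periodic, so with \<open>F\<close> the \<open>f_per\<close>-energy of \<open>u\<close> and
  \<open>C = c0 (1 + |\<xi>|\<^sup>p)\<close> the upper limit of \<open>M / r\<^sup>N\<close> is at most \<open>F / m\<^sup>N + C (1 - s\<^sup>N / m\<^sup>N)\<close>, whatever
  the centres of the large cubes. Let \<open>L\<close> be the infimum of these bounds over \<open>s\<close>, \<open>m\<close>, \<open>u\<close> and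
  the centre of the small cube. Since \<open>f \<ge> f_per\<close>, taking \<open>s = r\<close> and \<open>m = \<lceil>r\<rceil>\<close> in the definition of
  \<open>L\<close> turns it into a lower bound for \<open>M / r\<^sup>N\<close> that tends to \<open>L\<close>.
\<close>

section \<open>Cubes and translations of Lebesgue measure\<close>

lemma cube_eq_box: "cube \<rho> x = box (x - (\<chi> i. \<rho> / 2)) (x + (\<chi> i. \<rho> / 2))"
proof -
  have "\<bar>a - b\<bar> < \<rho> / 2 \<longleftrightarrow> b - \<rho> / 2 < a \<and> a < b + \<rho> / 2" for a b :: real
    by linarith
  then show ?thesis by (simp add: cube_def mem_box_cart set_eq_iff del: less_divide_eq_numeral1)
qed

lemma lmeasurable_cube: "cube \<rho> x \<in> lmeasurable"
  by (simp add: cube_eq_box)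

lemma measure_cube:
  fixes x :: "real^'n"
  assumes "0 \<le> \<rho>"
  shows "measure lebesgue (cube \<rho> x) = \<rho> ^ CARD('n)"
proof -
  let ?c = "(\<chi> i. \<rho> / 2) :: real^'n"
  have "measure lebesgue (cube \<rho> x) = measure lborel (cbox (x - ?c) (x + ?c))"
    unfolding cube_eq_box by (simp add: measure_lborel_box_eq measure_lborel_cbox_eq)
  also have "\<dots> = (\<Prod>i\<in>UNIV. (x + ?c) $ i - (x - ?c) $ i)"
    using assms by (subst content_cbox_cart) (auto simp: interval_eq_empty_cart not_less)
  also have "\<dots> = \<rho> ^ CARD('n)" by simp
  finally show ?thesis .
qed

lemma cube_translate: "x - z \<in> cube \<rho> y \<longleftrightarrow> x \<in> cube \<rho> (y + z)"
  by (auto simp: cube_def algebra_simps)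

text \<open>This is the affine change of variables with all scaling factors equal to 1. The measure
  is the completed one on both sides, so measurability concerns preimages of all Lebesgue sets and
  not only of Borel sets.\<close>

lemma distr_lebesgue_translate: "distr lebesgue lebesgue (\<lambda>x. t + x) = (lebesgue :: 'a::euclidean_space measure)"
  and measurable_lebesgue_translate: "(\<lambda>x. t + x) \<in> lebesgue \<rightarrow>\<^sub>M (lebesgue :: 'a::euclidean_space measure)"
proof -
  have T: "(\<lambda>x. t + (\<Sum>j\<in>Basis. (1 * (x \<bullet> j)) *\<^sub>R j)) = (\<lambda>x. t + x)"
    by (simp add: euclidean_representation)
  show "distr lebesgue lebesgue (\<lambda>x. t + x) = (lebesgue :: 'a measure)"
    using lebesgue_affine_euclidean[of "\<lambda>_. 1" t] unfolding T
    by (simp only: abs_one prod.neutral_const ennreal_1 density_1 one_neq_zero simp_thms)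
  show "(\<lambda>x. t + x) \<in> lebesgue \<rightarrow>\<^sub>M (lebesgue :: 'a measure)"
    using lebesgue_affine_measurable[of "\<lambda>_. 1" t] unfolding T by simp
qed

lemma lebesgue_integrable_translate_iff:
  fixes F :: "'a::euclidean_space \<Rightarrow> 'b::{banach, second_countable_topology}"
  shows "integrable lebesgue (\<lambda>x. F (x - z)) \<longleftrightarrow> integrable lebesgue F"
proof -
  have *: "integrable lebesgue (\<lambda>x. F (t + x))" if "integrable lebesgue F" for F :: "'a \<Rightarrow> 'b" and t
    by (rule integrable_distr[OF measurable_lebesgue_translate])
      (simp add: distr_lebesgue_translate that)
  show ?thesis
    using *[of F "- z"] *[of "\<lambda>x. F (x - z)" z] by auto
qed

lemma lebesgue_integral_translate:
  fixes F :: "'a::euclidean_space \<Rightarrow> 'b::{banach, second_countable_topology}"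
  shows "(LINT x|lebesgue. F (x - z)) = (LINT x|lebesgue. F x)"
proof (cases "integrable lebesgue F")
  case True
  have "(LINT x|lebesgue. F x) = (LINT x|distr lebesgue lebesgue (\<lambda>x. - z + x). F x)"
    by (simp only: distr_lebesgue_translate)
  also have "\<dots> = (LINT x|lebesgue. F (- z + x))"
    using True by (intro integral_distr measurable_lebesgue_translate) auto
  finally show ?thesis by simp
next
  \<comment> \<open>Without integrability both sides take the default value 0.\<close>
  case False
  then show ?thesis
    by (simp add: not_integrable_integral_eq lebesgue_integrable_translate_iff)
qed

lemma lebesgue_measurable_translate:
  assumes "F \<in> borel_measurable lebesgue"
  shows "(\<lambda>x. F (x - z)) \<in> borel_measurable (lebesgue :: 'a::euclidean_space measure)"
  using measurable_compose[OF measurable_lebesgue_translate[of "- z"] assms] by simp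

lemma AE_lebesgue_translate:
  assumes "AE x in lebesgue. P x"
  shows "AE x in (lebesgue :: 'a::euclidean_space measure). P (x - z)"
proof -
  have "AE x in distr lebesgue lebesgue (\<lambda>x. - z + x). P x"
    by (simp only: distr_lebesgue_translate assms)
  from AE_distrD[OF measurable_lebesgue_translate this] show ?thesis by simp
qed

section \<open>Integrands composed with measurable functions\<close>

text \<open>Completeness of Lebesgue measure: the two preimages of a Borel set differ inside a null
  set, all of whose subsets are measurable. This takes care of the null set of points at which a
  Caratheodory integrand may be discontinuous in its second argument.\<close>

lemma borel_measurable_lebesgue_AE_eq:
  fixes g h :: "'a::euclidean_space \<Rightarrow> 'b::topological_space"
  assumes g: "g \<in> borel_measurable lebesgue" and ae: "AE x in lebesgue. h x = g x"
  shows "h \<in> borel_measurable lebesgue"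
proof (rule measurableI)
  fix B :: "'b set" assume B: "B \<in> sets borel"
  obtain N where N: "N \<in> null_sets lebesgue" "{x. h x \<noteq> g x} \<subseteq> N"
    using ae by (auto simp: eventually_ae_filter)
  have "h -` B = (g -` B - N) \<union> (h -` B \<inter> N)" using N(2) by auto
  moreover have "g -` B \<in> sets lebesgue" using measurable_sets[OF g B] by simp
  moreover have "h -` B \<inter> N \<in> sets lebesgue"
    by (rule null_setsD2[OF null_sets_completion_subset[OF _ N(1)]]) simp
  ultimately show "h -` B \<inter> space lebesgue \<in> sets lebesgue"
    using null_setsD2[OF N(1)] by (metis Int_UNIV_right space_completion space_lborel sets.Un sets.Diff space_borel)
qed simp

text \<open>Along a simple function only finitely many values are inserted, so measurability in
  \<open>x\<close> for each fixed value is enough; continuity in the second argument carries it over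
  to the pointwise limit \<open>v\<close>.\<close>

lemma caratheodory_comp_measurable:
  fixes f :: "real^'n \<Rightarrow> real^'d \<Rightarrow> real"
  assumes f: "caratheodory f" and v: "v \<in> borel_measurable lebesgue"
  shows "(\<lambda>x. f x (v x)) \<in> borel_measurable lebesgue"
proof -
  obtain s where s: "\<And>i. simple_function lebesgue (s i)" "\<And>x. (\<lambda>i. s i x) \<longlonglongrightarrow> v x"
    using borel_measurable_implies_sequence_metric[OF v, of 0] by auto
  define C where "C = {x. continuous_on UNIV (f x)}"
  have C: "AE x in lebesgue. x \<in> C" using f by (simp add: caratheodory_def C_def)
  then have CS: "C \<in> sets lebesgue"
    using sets_completion_AE[of "\<lambda>x. x \<notin> C" lborel]
    by (auto simp: AE_completion_iff pred_def Collect_neg_eq sets.compl_sets dest: sets.compl_sets)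
  have "(\<lambda>x. f x (s i x)) \<in> borel_measurable lebesgue" for i
  proof (rule measurable_compose_countable'[where f = "\<lambda>c x. f x c" and g = "s i" and I = "range (s i)"])
    show "s i \<in> lebesgue \<rightarrow>\<^sub>M count_space (range (s i))"
      using simple_functionD[OF s(1)[of i]]
      by (subst measurable_count_space_eq2) (auto simp: countable_finite)
    show "countable (range (s i))"
      using simple_functionD(1)[OF s(1)[of i]] by (simp add: countable_finite)
    show "(\<lambda>x. f x c) \<in> borel_measurable lebesgue" for c
      using f by (simp add: caratheodory_def)
  qed
  \<comment> \<open>The factor \<open>indicator C\<close> makes the convergence hold at every point,
    including those where \<open>f x\<close> is discontinuous.\<close>
  then have m: "(\<lambda>x. indicator C x * f x (s i x)) \<in> borel_measurable lebesgue" for i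
    using CS by (intro borel_measurable_times borel_measurable_indicator) auto
  have "(\<lambda>x. indicator C x * f x (v x)) \<in> borel_measurable lebesgue"
  proof (rule borel_measurable_LIMSEQ_metric[OF m])
    fix x :: "real^'n"
    show "(\<lambda>i. indicator C x * f x (s i x)) \<longlonglongrightarrow> indicator C x * f x (v x)"
    proof (cases "x \<in> C")
      case True
      then have "isCont (f x) (v x)" by (simp add: C_def continuous_on_eq_continuous_at)
      then show ?thesis using isCont_tendsto_compose[OF _ s(2)[of x]] True by simp
    qed simp
  qed
  then show ?thesis
    by (rule borel_measurable_lebesgue_AE_eq) (use C in eventually_elim, simp)
qed

lemma powr_add_le:
  fixes a b :: real
  assumes "0 \<le> a" "0 \<le> b" "0 \<le> p"
  shows "(a + b) powr p \<le> 2 powr p * (a powr p + b powr p)"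
proof -
  have "(a + b) powr p \<le> (2 * max a b) powr p"
    using assms by (intro powr_mono2) auto
  also have "\<dots> = 2 powr p * max a b powr p"
    using assms by (simp add: powr_mult)
  also have "max a b powr p \<le> a powr p + b powr p"
    by (simp add: max_def)
  finally show ?thesis by simp
qed

text \<open>The upper growth bound and \<open>powr_add_le\<close> dominate the integrand by a
  constant plus a multiple of \<open>norm (u x) powr p\<close>; the constant is integrable because
  \<open>D\<close> has finite measure.\<close>

lemma integrands_comp_integrable:
  fixes f :: "real^'n \<Rightarrow> real^'d \<Rightarrow> real"
  assumes f: "f \<in> integrands c0 p" and u: "Lp p D u" and D: "D \<in> lmeasurable"
    and p: "1 < p" and c0: "1 \<le> c0"
  shows "set_integrable lebesgue D (\<lambda>x. f x (\<xi> + u x))"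
proof -
  define B where "B x = c0 * (1 + 2 powr p * (norm \<xi> powr p + norm (u x) powr p))" for x
  have "set_integrable lebesgue D (\<lambda>x. c0 * (1 + 2 powr p * norm \<xi> powr p) 
      + c0 * 2 powr p * norm (u x) powr p)"
    using u D
    by (intro set_integral_add set_integrable_mult_right)
      (simp_all add: Lp_def absolutely_integrable_on_const)
  moreover have "B = (\<lambda>x. c0 * (1 + 2 powr p * norm \<xi> powr p) + c0 * 2 powr p * norm (u x) powr p)"
    by (simp add: B_def fun_eq_iff algebra_simps)
  ultimately have "set_integrable lebesgue D B" by simp
  moreover have "set_borel_measurable lebesgue D (\<lambda>x. f x (\<xi> + u x))"
  proof -
    \<comment> \<open>Only the product of \<open>u\<close> with the indicator of \<open>D\<close> is
      known to be measurable on the whole space, so the composition is formed with this product,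
      which agrees with \<open>u\<close> on \<open>D\<close>.\<close>
    have "(\<lambda>x. f x (\<xi> + indicator D x *\<^sub>R u x)) \<in> borel_measurable lebesgue"
      using f u by (intro caratheodory_comp_measurable borel_measurable_add)
        (auto simp: integrands_def Lp_def set_borel_measurable_def)
    then have "(\<lambda>x. indicator D x *\<^sub>R f x (\<xi> + indicator D x *\<^sub>R u x)) \<in> borel_measurable lebesgue"
      using D by (intro borel_measurable_scaleR borel_measurable_indicator) auto
    then show ?thesis
      unfolding set_borel_measurable_def
      by (rule measurable_cong[THEN iffD1, rotated]) (auto split: split_indicator)
  qed
  moreover have "norm (f x (\<xi> + u x)) \<le> norm (B x)" for x
  proof -
    have "f x (\<xi> + u x) \<le> c0 * (1 + norm (\<xi> + u x) powr p)"
      using f by (auto simp: integrands_def p_growth_def)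
    also have "norm (\<xi> + u x) powr p \<le> (norm \<xi> + norm (u x)) powr p"
      using p by (intro powr_mono2 norm_triangle_ineq) auto
    also have "\<dots> \<le> 2 powr p * (norm \<xi> powr p + norm (u x) powr p)"
      using p by (intro powr_add_le) auto
    finally show ?thesis
      using f c0 by (auto simp: B_def integrands_def)
  qed
  ultimately show ?thesis
    using set_integrable_bound[of lebesgue D B "\<lambda>x. f x (\<xi> + u x)"] by simp
qed

section \<open>Translating test functions and Sobolev functions\<close>

lemma set_integral_translate:
  fixes F :: "'a::euclidean_space \<Rightarrow> 'b::{banach, second_countable_topology}"
  shows "(LINT x:{x. x - z \<in> E}|lebesgue. F (x - z)) = (LINT x:E|lebesgue. F x)"
    and "set_integrable lebesgue {x. x - z \<in> E} (\<lambda>x. F (x - z)) \<longleftrightarrow> set_integrable lebesgue E F"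
  using lebesgue_integral_translate[of "\<lambda>x. indicator E x *\<^sub>R F x" z]
    lebesgue_integrable_translate_iff[of "\<lambda>x. indicator E x *\<^sub>R F x" z]
  by (simp_all add: set_lebesgue_integral_def set_integrable_def indicator_def)

lemma translate_set_eq: "{x. x - z \<in> E} = (+) z ` E" for z :: "'a::ab_group_add"
  by force

lemma Lp_translate:
  assumes "Lp p E u"
  shows "Lp p {x. x - z \<in> E} (\<lambda>x. u (x - z))"
proof -
  have "(\<lambda>x. indicator E x *\<^sub>R u x) \<in> borel_measurable lebesgue"
    using assms by (simp add: Lp_def set_borel_measurable_def)
  from lebesgue_measurable_translate[OF this, of z]
  have "set_borel_measurable lebesgue {x. x - z \<in> E} (\<lambda>x. u (x - z))"
    by (simp add: set_borel_measurable_def indicator_def)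
  moreover have "set_integrable lebesgue {x. x - z \<in> E} (\<lambda>x. norm (u (x - z)) powr p)"
    using assms set_integral_translate(2)[of z E "\<lambda>x. norm (u x) powr p"] by (simp add: Lp_def)
  ultimately show ?thesis by (simp add: Lp_def)
qed

lemma Lp_subset:
  assumes "Lp p D u" "E \<subseteq> D" "E \<in> sets lebesgue"
  shows "Lp p E u"
  using assms unfolding Lp_def
  by (blast intro: set_borel_measurable_subset set_integrable_subset)

text \<open>Young's inequality bounds the pairing by a combination of the two integrable powers. A
  general bilinear \<open>h\<close> covers both sides of the constraint in
  \<open>U_eta_c\<close>.\<close>

lemma Lp_bilinear_integrable:
  fixes h :: "'b::euclidean_space \<Rightarrow> 'c::euclidean_space \<Rightarrow> real"
  assumes pq: "1 < p" "1 < q" "1 / p + 1 / q = 1" and h: "bounded_bilinear h"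
    and u: "Lp p D u" and G: "Lp q D G"
  shows "set_integrable lebesgue D (\<lambda>x. h (u x) (G x))"
proof -
  interpret bounded_bilinear h by fact
  obtain K where K: "0 < K" "\<And>a b. norm (h a b) \<le> norm a * norm b * K"
    using pos_bounded by blast
  let ?B = "\<lambda>x. K / p * norm (u x) powr p + K / q * norm (G x) powr q"
  have B: "set_integrable lebesgue D ?B"
    using u G by (intro set_integral_add set_integrable_mult_right) (simp_all add: Lp_def)
  have "continuous_on UNIV (\<lambda>x. h (fst x) (snd x))"
    by (intro continuous_on continuous_on_fst continuous_on_snd continuous_on_id)
  then have "(\<lambda>x. h (indicator D x *\<^sub>R u x) (indicator D x *\<^sub>R G x)) \<in> borel_measurable lebesgue"
    by (rule borel_measurable_continuous_Pair[rotated 2])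
      (use u G in \<open>simp_all add: Lp_def set_borel_measurable_def\<close>)
  moreover have "(\<lambda>x. h (indicator D x *\<^sub>R u x) (indicator D x *\<^sub>R G x)) =
      (\<lambda>x. indicator D x *\<^sub>R h (u x) (G x))"
    by (auto simp: fun_eq_iff indicator_def zero_left)
  ultimately have m: "set_borel_measurable lebesgue D (\<lambda>x. h (u x) (G x))"
    by (simp add: set_borel_measurable_def)
  have "norm (h (u x) (G x)) \<le> norm (?B x)" for x
  proof -
    have "norm (u x) * norm (G x) * K \<le> (norm (u x) powr p / p + norm (G x) powr q / q) * K"
      using pq K(1) by (intro mult_right_mono Youngs_inequality) auto
    also have "\<dots> = ?B x" by (simp add: algebra_simps)
    finally show ?thesis using K(2)[of "u x" "G x"] by simp
  qed
  with set_integrable_bound[OF B m] show ?thesis by simp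
qed

lemma has_derivative_translate:
  assumes "h differentiable (at (x - z))"
  shows "((\<lambda>x. h (x - z)) has_derivative frechet_derivative h (at (x - z))) (at x)"
proof -
  have "((\<lambda>x. x - z) has_derivative (\<lambda>x. x)) (at x)"
    by (auto intro!: derivative_eq_intros)
  moreover have "(h has_derivative frechet_derivative h (at (x - z))) (at (x - z))"
    using assms by (simp add: frechet_derivative_works[symmetric])
  ultimately show ?thesis by (rule has_derivative_compose)
qed

lemma frechet_derivative_translate:
  assumes "h differentiable (at (x - z))"
  shows "frechet_derivative (\<lambda>x. h (x - z)) (at x) = frechet_derivative h (at (x - z))"
  using has_derivative_translate[OF assms] by (metis frechet_derivative_at)

lemma Ck_translate: "Ck k h \<Longrightarrow> Ck k (\<lambda>x. h (x - z))"
proof (induction k arbitrary: h)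
  case 0
  then show ?case
    by (auto intro!: continuous_on_compose2[of UNIV h] continuous_intros)
next
  case (Suc k)
  then show ?case
    using has_derivative_translate[of h _ z]
    by (auto simp: frechet_derivative_translate) (auto simp: differentiable_def)
qed

lemma smooth_differentiable: "smooth h \<Longrightarrow> h differentiable (at x)"
  unfolding smooth_def by (metis Ck.simps(2))

lemma compactly_inside_subset:
  fixes S :: "'a::t2_space set"
  assumes "S \<subseteq> K" "compact K" "K \<subseteq> D"
  shows "compactly_inside S D"
proof -
  have "closure S \<subseteq> K" using assms by (simp add: closure_minimal compact_imp_closed)
  then have "closure S = K \<inter> closure S" by blast
  then have "compact (closure S)" using assms(2) by (metis closed_closure compact_Int_closed)
  then show ?thesis using \<open>closure S \<subseteq> K\<close> assms(3) by (auto simp: compactly_inside_def)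
qed

lemma compactly_inside_translate:
  fixes D :: "'a::real_normed_vector set"
  assumes "compactly_inside S D"
  shows "compactly_inside {x. x - z \<in> S} {x. x - z \<in> D}"
proof (rule compactly_inside_subset)
  show "compact ((+) z ` closure S)"
    using assms by (intro compact_translation) (simp add: compactly_inside_def)
  show "{x. x - z \<in> S} \<subseteq> (+) z ` closure S"
    unfolding translate_set_eq using closure_subset[of S] by blast
  show "(+) z ` closure S \<subseteq> {x. x - z \<in> D}"
    using assms by (auto simp: compactly_inside_def)
qed

lemma test_fun_translate:
  assumes "test_fun D \<phi>"
  shows "test_fun {x. x - z \<in> D} (\<lambda>x. \<phi> (x - z))"
  using assms compactly_inside_translate[of "{x. \<phi> x \<noteq> 0}" D z]
  by (simp add: test_fun_def smooth_def Ck_translate)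

lemma W1q_translate:
  assumes "W1q q E \<psi> G"
  shows "W1q q {x. x - z \<in> E} (\<lambda>x. \<psi> (x - z)) (\<lambda>x. G (x - z))"
  unfolding W1q_def
proof (intro conjI allI impI)
  show "Lp q {x. x - z \<in> E} (\<lambda>x. \<psi> (x - z))" "Lp q {x. x - z \<in> E} (\<lambda>x. G (x - z))"
    using assms by (auto simp: W1q_def intro: Lp_translate)
  fix \<phi> :: "real^'a \<Rightarrow> real" and i
  assume "test_fun {x. x - z \<in> E} \<phi>"
  \<comment> \<open>The test function is moved back to \<open>E\<close>, where the weak derivative
    identity for \<psi> is available.\<close>
  define \<phi>' where "\<phi>' x = \<phi> (x - (- z))" for x
  have \<phi>': "test_fun E \<phi>'"
    using test_fun_translate[OF \<open>test_fun _ \<phi>\<close>, of "- z"] by (simp add: \<phi>'_def[abs_def])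
  have "smooth \<phi>'" using \<phi>' by (simp add: test_fun_def)
  have \<phi>: "\<phi> = (\<lambda>x. \<phi>' (x - z))" by (simp add: \<phi>'_def)
  have d: "partial_deriv i \<phi> x = partial_deriv i \<phi>' (x - z)" for x
    unfolding \<phi> partial_deriv_def by (simp add: frechet_derivative_translate smooth_differentiable[OF \<open>smooth \<phi>'\<close>])
  have "(LINT x:E|lebesgue. partial_deriv i \<phi>' x *\<^sub>R \<psi> x) =
      - (LINT x:E|lebesgue. \<phi>' x *\<^sub>R column i (G x))"
    using assms \<phi>' by (simp add: W1q_def)
  then show "(LINT x:{x. x - z \<in> E}|lebesgue. partial_deriv i \<phi> x *\<^sub>R \<psi> (x - z)) =
      - (LINT x:{x. x - z \<in> E}|lebesgue. \<phi> x *\<^sub>R column i (G (x - z)))"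
    unfolding d unfolding \<phi>
    using set_integral_translate(1)[of z E "\<lambda>x. partial_deriv i \<phi>' x *\<^sub>R \<psi> x"]
      set_integral_translate(1)[of z E "\<lambda>x. \<phi>' x *\<^sub>R column i (G x)"] by simp
qed

text \<open>A test function on \<open>E\<close> is one on \<open>D\<close>, and it and its
  derivatives vanish off \<open>E\<close>, so the two weak derivative identities have the same
  integrals. No boundary values enter, which later allows the constraint on a large cube to be split
  over small ones.\<close>

lemma W1q_subset:
  assumes W: "W1q q D \<psi> G" and E: "E \<subseteq> D" "E \<in> sets lebesgue"
  shows "W1q q E \<psi> G"
  unfolding W1q_def
proof (intro conjI allI impI)
  show "Lp q E \<psi>" "Lp q E G"
    using W E by (auto simp: W1q_def intro: Lp_subset)
  fix \<phi> :: "real^'a \<Rightarrow> real" and i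
  assume \<phi>: "test_fun E \<phi>"
  then have "test_fun D \<phi>" using E(1) by (auto simp: test_fun_def compactly_inside_def)
  have z: "\<phi> x = 0" "partial_deriv i \<phi> x = 0" if "x \<notin> E" for x
  proof -
    let ?S = "{x. \<phi> x \<noteq> 0}"
    have x: "x \<in> - closure ?S" using \<phi> that by (auto simp: test_fun_def compactly_inside_def)
    then show "\<phi> x = 0" using closure_subset[of ?S] by auto
    \<comment> \<open>The complement of the closed support is open and \<phi> is zero on it, hence
      so is its derivative.\<close>
    have "(\<phi> has_derivative (\<lambda>_. 0)) (at x)"
      by (rule has_derivative_transform_within_open[of "\<lambda>_. 0" _ _ _ "- closure ?S"])
        (use x closure_subset[of ?S] in auto)
    then show "partial_deriv i \<phi> x = 0"
      by (simp add: partial_deriv_def frechet_derivative_at[symmetric])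
  qed
  have "(LINT x:E|lebesgue. partial_deriv i \<phi> x *\<^sub>R \<psi> x) = (LINT x:D|lebesgue. partial_deriv i \<phi> x *\<^sub>R \<psi> x)"
    "(LINT x:E|lebesgue. \<phi> x *\<^sub>R column i (G x)) = (LINT x:D|lebesgue. \<phi> x *\<^sub>R column i (G x))"
    unfolding set_lebesgue_integral_def using z E(1)
    by (intro arg_cong[where f = "lebesgue_integral lebesgue"]; force simp: fun_eq_iff indicator_def)+
  with W \<open>test_fun D \<phi>\<close> show "(LINT x:E|lebesgue. partial_deriv i \<phi> x *\<^sub>R \<psi> x) =
      - (LINT x:E|lebesgue. \<phi> x *\<^sub>R column i (G x))"
    by (simp add: W1q_def)
qed

lemma ess_supp_translate:
  "ess_supp {x. x - z \<in> D} (\<lambda>x. u (x - z)) \<subseteq> {x. x - z \<in> ess_supp D u}"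
proof
  fix x assume x: "x \<in> ess_supp {x. x - z \<in> D} (\<lambda>x. u (x - z))"
  then have x': "x \<notin> U" if "open U" "AE y in lebesgue. y \<in> {x. x - z \<in> D} \<inter> U \<longrightarrow> u (y - z) = 0" for U
    using that unfolding ess_supp_def by blast
  have False if U: "open U" "AE y in lebesgue. y \<in> D \<inter> U \<longrightarrow> u y = 0" "x - z \<in> U" for U
  proof -
    have "open {x. x - z \<in> U}"
      using U(1) by (simp add: translate_set_eq open_translation)
    moreover have "AE y in lebesgue. y \<in> {x. x - z \<in> D} \<inter> {x. x - z \<in> U} \<longrightarrow> u (y - z) = 0"
      using AE_lebesgue_translate[OF U(2), of z] by simp
    ultimately show False using x' U(3) by blast
  qed
  moreover have "x - z \<in> D" using x unfolding ess_supp_def by blast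
  ultimately show "x \<in> {x. x - z \<in> ess_supp D u}" unfolding ess_supp_def by blast
qed

text \<open>The set removed in \<open>ess_supp\<close> is a possibly uncountable union of open sets.
  Lindelof's theorem reduces it to a countable union, for which the exceptional null sets still add
  up to a null set.\<close>

lemma AE_zero_outside_ess_supp:
  "AE x in lebesgue. x \<in> D \<longrightarrow> x \<notin> ess_supp D u \<longrightarrow> u x = 0"
proof -
  let ?F = "{U. open U \<and> (AE x in lebesgue. x \<in> D \<inter> U \<longrightarrow> u x = 0)}"
  obtain F' where F': "F' \<subseteq> ?F" "countable F'" "\<Union>F' = \<Union>?F"
    using Lindelof[of ?F] by blast
  have "AE x in lebesgue. \<forall>U\<in>F'. x \<in> D \<inter> U \<longrightarrow> u x = 0"
    using F'(1) by (intro AE_ball_countable[OF F'(2), THEN iffD2]) auto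
  then show ?thesis
  proof eventually_elim
    case (elim x)
    then show ?case using F'(3) by (auto simp: ess_supp_def)
  qed
qed

section \<open>Gluing and translating competitors\<close>

text \<open>The sum form puts 0 off the pieces and reduces measurability to that of finitely many
  summands; on disjoint pieces at most one summand survives.\<close>

definition glue :: "'j set \<Rightarrow> ('j \<Rightarrow> 'a set) \<Rightarrow> ('j \<Rightarrow> 'a \<Rightarrow> 'b::real_vector) \<Rightarrow> 'a \<Rightarrow> 'b" where
  "glue J E w x = (\<Sum>j\<in>J. indicator (E j) x *\<^sub>R w j x)"

lemma glue_eq:
  assumes "finite J" "disjoint_family_on E J" "j \<in> J" "x \<in> E j"
  shows "glue J E w x = w j x"
proof -
  have "indicator (E i) x *\<^sub>R w i x = (if i = j then w j x else 0)" if "i \<in> J" for i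
    using assms that by (auto simp: disjoint_family_on_def indicator_def)
  then have "glue J E w x = (\<Sum>i\<in>J. if i = j then w j x else 0)"
    unfolding glue_def by (intro sum.cong) auto
  then show ?thesis using assms by simp
qed

lemma glue_eq_0: "(\<And>j. j \<in> J \<Longrightarrow> x \<notin> E j) \<Longrightarrow> glue J E w x = 0"
  by (simp add: glue_def)

lemma set_integral_disjoint_pieces:
  fixes F :: "'a \<Rightarrow> 'b::{banach, second_countable_topology}"
  assumes J: "finite J" "disjoint_family_on E J"
    and E: "\<And>j. j \<in> J \<Longrightarrow> E j \<in> sets M" "\<And>j. j \<in> J \<Longrightarrow> E j \<subseteq> D"
    and F: "\<And>j. j \<in> J \<Longrightarrow> set_integrable M (E j) F"
    and 0: "\<And>x. x \<in> D \<Longrightarrow> (\<And>j. j \<in> J \<Longrightarrow> x \<notin> E j) \<Longrightarrow> F x = 0"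
  shows "set_integrable M D F" "(LINT x:D|M. F x) = (\<Sum>j\<in>J. LINT x:E j|M. F x)"
proof -
  have *: "(\<lambda>x. indicator D x *\<^sub>R F x) = (\<lambda>x. indicator (\<Union>j\<in>J. E j) x *\<^sub>R F x)"
  proof
    fix x show "indicator D x *\<^sub>R F x = indicator (\<Union>j\<in>J. E j) x *\<^sub>R F x"
      using E(2) 0[of x] by (cases "x \<in> (\<Union>j\<in>J. E j)") (auto simp: indicator_def)
  qed
  show "set_integrable M D F"
    using set_integrable_UN[of J M E F] J E F unfolding set_integrable_def * by blast
  show "(LINT x:D|M. F x) = (\<Sum>j\<in>J. LINT x:E j|M. F x)"
    using set_integral_finite_Union[of J E M F] J E F unfolding set_lebesgue_integral_def * by blast
qed

text \<open>The condition \<open>F x 0 = 0\<close> keeps the gaps between the pieces from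
  contributing. It is met by the mean value, by \<open>norm a powr p\<close> and by the pairings
  with a Sobolev gradient, to which the lemma is applied.\<close>

lemma glue_integral:
  fixes F :: "'a \<Rightarrow> 'c::real_vector \<Rightarrow> 'b::{banach, second_countable_topology}"
  assumes J: "finite J" "disjoint_family_on E J"
    and E: "\<And>j. j \<in> J \<Longrightarrow> E j \<in> sets M" "\<And>j. j \<in> J \<Longrightarrow> E j \<subseteq> D"
    and F: "\<And>j. j \<in> J \<Longrightarrow> set_integrable M (E j) (\<lambda>x. F x (w j x))"
    and 0: "\<And>x. F x 0 = 0"
  shows "set_integrable M D (\<lambda>x. F x (glue J E w x))"
    "(LINT x:D|M. F x (glue J E w x)) = (\<Sum>j\<in>J. LINT x:E j|M. F x (w j x))"
proof -
  have eq: "F x (glue J E w x) = F x (w j x)" if "j \<in> J" "x \<in> E j" for j x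
    using glue_eq[OF J that, of w] by simp
  have int: "set_integrable M (E j) (\<lambda>x. F x (glue J E w x))" if "j \<in> J" for j
    using F[OF that] eq[OF that] by (subst set_integrable_cong[OF refl refl]) auto
  have z: "F x (glue J E w x) = 0" if "\<And>j. j \<in> J \<Longrightarrow> x \<notin> E j" for x
    using that by (simp add: glue_eq_0 0)
  show "set_integrable M D (\<lambda>x. F x (glue J E w x))"
    by (rule set_integral_disjoint_pieces(1)[OF J E int z])
  have "(LINT x:D|M. F x (glue J E w x)) = (\<Sum>j\<in>J. LINT x:E j|M. F x (glue J E w x))"
    by (rule set_integral_disjoint_pieces(2)[OF J E int z])
  also have "\<dots> = (\<Sum>j\<in>J. LINT x:E j|M. F x (w j x))"
    using eq E(1) by (intro sum.cong refl set_lebesgue_integral_cong) auto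
  finally show "(LINT x:D|M. F x (glue J E w x)) = (\<Sum>j\<in>J. LINT x:E j|M. F x (w j x))" .
qed

lemma Lp_glue:
  assumes J: "finite J" "disjoint_family_on E J"
    and E: "\<And>j. j \<in> J \<Longrightarrow> E j \<in> sets lebesgue" "\<And>j. j \<in> J \<Longrightarrow> E j \<subseteq> D"
    and D: "D \<in> sets lebesgue"
    and w: "\<And>j. j \<in> J \<Longrightarrow> Lp p (E j) (w j)"
  shows "Lp p D (glue J E w)"
    "(LINT x:D|lebesgue. norm (glue J E w x) powr p) = (\<Sum>j\<in>J. LINT x:E j|lebesgue. norm (w j x) powr p)"
proof -
  have i: "set_integrable lebesgue (E j) (\<lambda>x. norm (w j x) powr p)" if "j \<in> J" for j
    using w[OF that] by (simp add: Lp_def)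
  have "glue J E w \<in> borel_measurable lebesgue"
    unfolding glue_def[abs_def] using w
    by (intro borel_measurable_sum) (simp add: Lp_def set_borel_measurable_def)
  then have "set_borel_measurable lebesgue D (glue J E w)"
    unfolding set_borel_measurable_def
    using D by (intro borel_measurable_scaleR borel_measurable_indicator)
  then show "Lp p D (glue J E w)"
    using glue_integral(1)[of J E lebesgue D "\<lambda>x a. norm a powr p" w, OF J E i] by (simp add: Lp_def)
  show "(LINT x:D|lebesgue. norm (glue J E w x) powr p) = (\<Sum>j\<in>J. LINT x:E j|lebesgue. norm (w j x) powr p)"
    using glue_integral(2)[of J E lebesgue D "\<lambda>x a. norm a powr p" w, OF J E i] by simp
qed

text \<open>Pointwise \<open>t \<le> 1 + t powr p\<close>, and constants are integrable on a set of
  finite measure.\<close>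

lemma Lp_integrable:
  assumes p: "1 \<le> p" and u: "Lp p D u" and D: "D \<in> lmeasurable"
  shows "set_integrable lebesgue D u"
proof (rule set_integrable_bound)
  show "set_integrable lebesgue D (\<lambda>x. 1 + norm (u x) powr p)"
    using u D by (intro set_integral_add) (auto simp: Lp_def)
  show "set_borel_measurable lebesgue D u"
    using u by (simp add: Lp_def)
  have "t \<le> 1 + t powr p" if "0 \<le> t" for t :: real
  proof (cases "t \<le> 1")
    case False
    then have "t powr 1 \<le> t powr p" using p by (intro powr_mono) auto
    then show ?thesis using False by simp
  qed (simp add: add_increasing2)
  then show "AE x in lebesgue. x \<in> D \<longrightarrow> norm (u x) \<le> norm (1 + norm (u x) powr p)"
    by (simp add: abs_of_nonneg)
qed

text \<open>Puts the terms on the left side of the constraint into the form that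
  \<open>Lp_bilinear_integrable\<close> asks for.\<close>

lemma bounded_bilinear_column:
  fixes B :: "real^'d^'l"
  shows "bounded_bilinear (\<lambda>a (G::real^'n^'l). (B *v a) \<bullet> column i G)"
proof -
  have "linear (column i :: real^'n^'l \<Rightarrow> _)"
    by (rule linearI) (simp_all add: column_def vec_eq_iff)
  then have "bounded_linear (column i :: real^'n^'l \<Rightarrow> _)"
    by (simp add: linear_conv_bounded_linear)
  from bounded_bilinear.comp[OF bounded_bilinear_inner matrix_vector_mul_bounded_linear[of B] this]
  show ?thesis .
qed

text \<open>The finite union \<open>?K\<close> of compact supports is compact, so its complement is
  open; the glued function vanishes almost everywhere on \<open>D\<close> there, and hence the
  complement is one of the open sets removed in \<open>ess_supp\<close>.\<close>

lemma compactly_inside_glue: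
  fixes D :: "(real^'n) set"
  assumes J: "finite J" and E: "\<And>j. j \<in> J \<Longrightarrow> E j \<subseteq> D"
    and u: "\<And>j. j \<in> J \<Longrightarrow> compactly_inside (ess_supp (E j) (u j)) (E j)"
  shows "compactly_inside (ess_supp D (glue J E u)) D"
proof (rule compactly_inside_subset)
  let ?K = "\<Union>j\<in>J. closure (ess_supp (E j) (u j))"
  show K: "compact ?K"
    using J u by (intro compact_UN) (auto simp: compactly_inside_def)
  show "?K \<subseteq> D"
    using E u unfolding compactly_inside_def by blast
  have "AE x in lebesgue. \<forall>j\<in>J. x \<in> E j \<longrightarrow> x \<notin> ess_supp (E j) (u j) \<longrightarrow> u j x = 0"
    using J by (intro AE_finite_allI AE_zero_outside_ess_supp)
  then have "AE x in lebesgue. x \<in> D \<inter> - ?K \<longrightarrow> glue J E u x = 0"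
  proof eventually_elim
    case (elim x)
    show ?case
    proof
      assume "x \<in> D \<inter> - ?K"
      then have "indicator (E j) x *\<^sub>R u j x = 0" if "j \<in> J" for j
        using elim that closure_subset[of "ess_supp (E j) (u j)"] by (auto simp: indicator_def)
      then show "glue J E u x = 0" unfolding glue_def by (intro sum.neutral ballI)
    qed
  qed
  moreover have "open (- ?K)" by (rule open_Compl[OF compact_imp_closed[OF K]])
  ultimately show "ess_supp D (glue J E u) \<subseteq> ?K"
    unfolding ess_supp_def by blast
qed

text \<open>The fields \<open>V\<close> are glued along with the competitors. A Sobolev function on
  \<open>D\<close> restricts to an admissible test function on each \<open>E j\<close>, and the
  identities on the pieces add up to the one on \<open>D\<close>. The bounds on \<open>V\<close> add
  up because the measures of the disjoint pieces do.\<close>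

lemma U_eta_c_glue:
  fixes A :: "'n::finite \<Rightarrow> real^'d^'l" and D :: "(real^'n) set"
  assumes pq: "1 < p" "1 < q" "1 / p + 1 / q = 1" and \<eta>: "0 < \<eta>"
    and D: "D \<in> lmeasurable" "0 < measure lebesgue D"
    and J: "finite J" "disjoint_family_on E J"
    and E: "\<And>j. j \<in> J \<Longrightarrow> E j \<in> lmeasurable" "\<And>j. j \<in> J \<Longrightarrow> E j \<subseteq> D"
    and u: "\<And>j. j \<in> J \<Longrightarrow> u j \<in> U_eta_c A p q \<eta> (E j)"
  shows "glue J E u \<in> U_eta_c A p q \<eta> D"
proof -
  note sets = fmeasurableD[OF E(1)] fmeasurableD[OF D(1)]
  have Lpu: "Lp p (E j) (u j)" and supp: "compactly_inside (ess_supp (E j) (u j)) (E j)"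
    and mean: "(LINT x:E j|lebesgue. u j x) = 0" if "j \<in> J" for j
    using u[OF that] by (auto simp: U_eta_c_def)
  have "\<forall>j\<in>J. \<exists>V. V \<in> V_eta p \<eta> (E j) \<and> (\<forall>(\<psi> :: real^'n \<Rightarrow> real^'l) G. W1q q (E j) \<psi> G \<longrightarrow>
        - (\<Sum>i\<in>UNIV. LINT x:E j|lebesgue. (A i *v u j x) \<bullet> column i (G x)) =
        (LINT x:E j|lebesgue. V x \<bullet> G x))"
    using u unfolding U_eta_c_def by blast
  from bchoice[OF this] obtain V where V: "\<And>j. j \<in> J \<Longrightarrow> V j \<in> V_eta p \<eta> (E j)"
    and eq: "\<And>j (\<psi> :: real^'n \<Rightarrow> real^'l) G. j \<in> J \<Longrightarrow> W1q q (E j) \<psi> G \<Longrightarrow>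
        - (\<Sum>i\<in>UNIV. LINT x:E j|lebesgue. (A i *v u j x) \<bullet> column i (G x)) =
        (LINT x:E j|lebesgue. V j x \<bullet> G x)"
    by blast
  have LpV: "Lp p (E j) (V j)"
    and bdV: "(LINT x:E j|lebesgue. norm (V j x) powr p) < \<eta> * measure lebesgue (E j)"
    if "j \<in> J" for j
    using V[OF that] by (auto simp: V_eta_def)
  have int: "set_integrable lebesgue (E j) (u j)" if "j \<in> J" for j
    using Lp_integrable[OF _ Lpu E(1)] pq that by simp
  have mean': "(LINT x:D|lebesgue. glue J E u x) = 0"
    using glue_integral(2)[of J E lebesgue D "\<lambda>x a. a" u, OF J sets(1) E(2) int] mean by simp
  have "(LINT x:D|lebesgue. norm (glue J E V x) powr p) = (\<Sum>j\<in>J. LINT x:E j|lebesgue. norm (V j x) powr p)"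
    by (rule Lp_glue(2)[OF J sets(1) E(2) sets(2) LpV])
  also have "\<dots> < \<eta> * measure lebesgue D"
  proof (cases "J = {}")
    \<comment> \<open>For an empty family the left side is 0 and strictness comes from the positive
      measure of \<open>D\<close>.\<close>
    case True
    then show ?thesis using \<eta> D by simp
  next
    case False
    then have "(\<Sum>j\<in>J. LINT x:E j|lebesgue. norm (V j x) powr p) < (\<Sum>j\<in>J. \<eta> * measure lebesgue (E j))"
      using J bdV by (intro sum_strict_mono) auto
    also have "\<dots> = \<eta> * measure lebesgue (\<Union>j\<in>J. E j)"
      using measure_finite_Union[OF J(1) _ J(2), of lebesgue] fmeasurableD2[OF E(1)] sets(1)
      by (simp add: sum_distrib_left image_subset_iff)
    also have "\<dots> \<le> \<eta> * measure lebesgue D"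
    proof (intro mult_left_mono measure_mono_fmeasurable)
      show "(\<Union>j\<in>J. E j) \<in> sets lebesgue"
        by (rule sets.finite_UN[OF J(1) sets(1)])
    qed (use E(2) D(1) \<eta> in auto)
    finally show ?thesis .
  qed
  finally have V': "glue J E V \<in> V_eta p \<eta> D"
    using Lp_glue(1)[OF J sets(1) E(2) sets(2) LpV] by (simp add: V_eta_def)
  have "- (\<Sum>i\<in>UNIV. LINT x:D|lebesgue. (A i *v glue J E u x) \<bullet> column i (G x)) =
        (LINT x:D|lebesgue. glue J E V x \<bullet> G x)" if W: "W1q q D \<psi> G" for \<psi> :: "real^'n \<Rightarrow> real^'l" and G
  proof -
    have Wj: "W1q q (E j) \<psi> G" if "j \<in> J" for j
      using W1q_subset[OF W E(2)[OF that] sets(1)[OF that]] .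
    have LpG: "Lp q (E j) G" if "j \<in> J" for j
      using Wj[OF that] unfolding W1q_def by blast
    have "(LINT x:D|lebesgue. (A i *v glue J E u x) \<bullet> column i (G x)) =
        (\<Sum>j\<in>J. LINT x:E j|lebesgue. (A i *v u j x) \<bullet> column i (G x))" for i
      using glue_integral(2)[of J E lebesgue D "\<lambda>x a. (A i *v a) \<bullet> column i (G x)" u, OF J sets(1) E(2)
          Lp_bilinear_integrable[OF pq bounded_bilinear_column Lpu LpG]]
      by (simp only: matrix_vector_mult_0_right inner_zero_left simp_thms)
    then have "- (\<Sum>i\<in>UNIV. LINT x:D|lebesgue. (A i *v glue J E u x) \<bullet> column i (G x)) =
        - (\<Sum>i\<in>UNIV. \<Sum>j\<in>J. LINT x:E j|lebesgue. (A i *v u j x) \<bullet> column i (G x))"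
      by simp
    also have "\<dots> = (\<Sum>j\<in>J. - (\<Sum>i\<in>UNIV. LINT x:E j|lebesgue. (A i *v u j x) \<bullet> column i (G x)))"
      by (simp only: sum_negf) (rule arg_cong[OF sum.swap])
    also have "\<dots> = (\<Sum>j\<in>J. LINT x:E j|lebesgue. V j x \<bullet> G x)"
      using eq Wj by (intro sum.cong) auto
    also have "\<dots> = (LINT x:D|lebesgue. glue J E V x \<bullet> G x)"
      using glue_integral(2)[of J E lebesgue D "\<lambda>x a. a \<bullet> G x" V, OF J sets(1) E(2)
          Lp_bilinear_integrable[OF pq bounded_bilinear_inner LpV LpG]]
      by (simp only: inner_zero_left simp_thms)
    finally show ?thesis .
  qed
  note eqn = this
  have Lp': "Lp p D (glue J E u)"
    by (rule Lp_glue(1)[OF J sets(1) E(2) sets(2) Lpu])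
  have supp': "compactly_inside (ess_supp D (glue J E u)) D"
    by (rule compactly_inside_glue[OF J(1) E(2) supp])
  have "\<forall>(\<psi> :: real^'n \<Rightarrow> real^'l) G. W1q q D \<psi> G \<longrightarrow> - (\<Sum>i\<in>UNIV. LINT x:D|lebesgue. (A i *v glue J E u x) \<bullet> column i (G x)) =
        (LINT x:D|lebesgue. glue J E V x \<bullet> G x)"
    using eqn by blast
  with V' Lp' supp' mean' show ?thesis
    unfolding U_eta_c_def mem_Collect_eq by (intro conjI) (assumption | rule bexI)+
qed

lemma U_eta_c_translate:
  fixes A :: "'n::finite \<Rightarrow> real^'d^'l" and E :: "(real^'n) set"
  assumes u: "u \<in> U_eta_c A p q \<eta> E"
  shows "(\<lambda>x. u (x - z)) \<in> U_eta_c A p q \<eta> {x. x - z \<in> E}"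
proof -
  let ?E = "{x. x - z \<in> E}"
  obtain V where V: "Lp p E V" "(LINT x:E|lebesgue. norm (V x) powr p) < \<eta> * measure lebesgue E"
    and eq: "\<And>(\<psi> :: real^'n \<Rightarrow> real^'l) G. W1q q E \<psi> G \<Longrightarrow>
        - (\<Sum>i\<in>UNIV. LINT x:E|lebesgue. (A i *v u x) \<bullet> column i (G x)) =
        (LINT x:E|lebesgue. V x \<bullet> G x)"
    using u unfolding U_eta_c_def V_eta_def by blast
  have V': "(\<lambda>x. V (x - z)) \<in> V_eta p \<eta> ?E"
    using V set_integral_translate(1)[of z E "\<lambda>x. norm (V x) powr p"]
    by (simp add: V_eta_def Lp_translate) (simp add: translate_set_eq measure_translation)
  have eqn: "- (\<Sum>i\<in>UNIV. LINT x:?E|lebesgue. (A i *v u (x - z)) \<bullet> column i (G x)) =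
        (LINT x:?E|lebesgue. V (x - z) \<bullet> G x)" if "W1q q ?E \<psi> G" for \<psi> :: "real^'n \<Rightarrow> real^'l" and G
  proof -
    \<comment> \<open>The test pair is pulled back to \<open>E\<close>, where the constraint on
      \<open>u\<close> holds with the untranslated field \<open>V\<close>.\<close>
    have "W1q q E (\<lambda>x. \<psi> (x + z)) (\<lambda>x. G (x + z))"
      using W1q_translate[OF that, of "- z"] by simp
    from eq[OF this] show ?thesis
      using set_integral_translate(1)[of z E "\<lambda>x. (A i *v u x) \<bullet> column i (G (x + z))" for i]
        set_integral_translate(1)[of z E "\<lambda>x. V x \<bullet> G (x + z)"] by simp
  qed
  have supp': "compactly_inside (ess_supp ?E (\<lambda>x. u (x - z))) ?E"
  proof -
    have c: "compactly_inside {x. x - z \<in> ess_supp E u} ?E"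
      using u by (intro compactly_inside_translate) (simp add: U_eta_c_def)
    show ?thesis
      by (rule compactly_inside_subset[OF order_trans[OF ess_supp_translate closure_subset]])
        (use c in \<open>auto simp: compactly_inside_def\<close>)
  qed
  have Lp': "Lp p ?E (\<lambda>x. u (x - z))" and mean': "(LINT x:?E|lebesgue. u (x - z)) = 0"
    using u by (auto simp: U_eta_c_def Lp_translate set_integral_translate(1))
  have "\<forall>(\<psi> :: real^'n \<Rightarrow> real^'l) G. W1q q ?E \<psi> G \<longrightarrow> - (\<Sum>i\<in>UNIV. LINT x:?E|lebesgue. (A i *v u (x - z)) \<bullet> column i (G x)) =
        (LINT x:?E|lebesgue. V (x - z) \<bullet> G x)"
    using eqn by blast
  with V' Lp' supp' mean' show ?thesis
    unfolding U_eta_c_def mem_Collect_eq by (intro conjI) (assumption | rule bexI)+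
qed

section \<open>Tiling a large cube by lattice translates\<close>

lemma U_eta_c_cube_nonempty:
  fixes A :: "'n::finite \<Rightarrow> real^'d^'l"
  assumes "1 < p" "1 < q" "1 / p + 1 / q = 1" "0 < \<eta>" "0 < r"
  shows "U_eta_c A p q \<eta> (cube r y) \<noteq> {}"
proof -
  \<comment> \<open>The gluing of an empty family is the zero function.\<close>
  have "glue ({} :: unit set) (\<lambda>_. {}) (\<lambda>_ _. 0) \<in> U_eta_c A p q \<eta> (cube r y)"
    using assms by (intro U_eta_c_glue) (auto simp: lmeasurable_cube measure_cube disjoint_family_on_def)
  then show ?thesis by blast
qed

text \<open>The product is formed in the integers, so that the coordinates are visibly integers and
  \<open>cube_periodic_int\<close> applies.\<close>

definition lattice_vec :: "nat \<Rightarrow> ('n \<Rightarrow> int) \<Rightarrow> real^'n" where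
  "lattice_vec m k = (\<chi> i. of_int (int m * k i))"

text \<open>Periodicity is given along single axis vectors only: two-sided induction on the integers
  treats one axis, and induction over finite sets of axes treats the whole vector.\<close>

lemma cube_periodic_int:
  fixes h :: "real^'n \<Rightarrow> 'b"
  assumes "cube_periodic 1 h"
  shows "h (x + (\<chi> i. of_int (k i))) = h x"
proof -
  have per: "h (x + axis i 1) = h x" for x i
    using assms by (simp add: cube_periodic_def)
  have step: "h (x + of_int n *\<^sub>R axis i 1) = h x" for x i and n :: int
  proof (induction n rule: int_induct[of _ 0])
    case (step1 n)
    then show ?case using per[of "x + of_int n *\<^sub>R axis i 1" i] by (simp add: algebra_simps)
  next
    case (step2 n)
    then show ?case using per[of "x + of_int (n - 1) *\<^sub>R axis i 1" i] by (simp add: algebra_simps)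
  qed simp
  have "h (x + (\<Sum>i\<in>S. of_int (k i) *\<^sub>R axis i 1)) = h x" if "finite S" for S
    using that
  proof (induction S)
    case (insert i S)
    then show ?case
      using step[of "x + (\<Sum>i\<in>S. of_int (k i) *\<^sub>R axis i 1)" "k i" i] by (simp add: algebra_simps)
  qed simp
  moreover have "((\<chi> i. of_int (k i)) :: real^'n) = (\<Sum>i\<in>UNIV. of_int (k i) *\<^sub>R axis i 1)"
    by (simp add: vec_eq_iff axis_def if_distrib[of "(*) _"] cong: if_cong)
  ultimately show ?thesis by simp
qed

text \<open>In a coordinate where the indices differ the centres are at least \<open>m\<close>
  apart, whereas cubes of side \<open>s\<close> with a common point have centres less than
  \<open>s\<close> apart in every coordinate.\<close>

lemma disjoint_lattice_cubes:
  assumes "s \<le> real m"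
  shows "disjoint_family_on (\<lambda>k. cube s (y + lattice_vec m k)) J"
proof -
  have "k = k'" if "x \<in> cube s (y + lattice_vec m k)" "x \<in> cube s (y + lattice_vec m k')" for x k k'
  proof
    fix i
    have "\<bar>x $ i - (y $ i + real m * k i)\<bar> < s / 2" "\<bar>x $ i - (y $ i + real m * k' i)\<bar> < s / 2"
      using that by (auto simp: cube_def lattice_vec_def)
    then have "\<bar>real m * k i - real m * k' i\<bar> < real m * 1" using assms by linarith
    then have "real m * \<bar>of_int (k i - k' i)\<bar> < real m * 1"
      by (simp add: abs_mult right_diff_distrib[symmetric])
    then have "\<bar>real_of_int (k i - k' i)\<bar> < 1"
      by (subst (asm) mult_less_cancel_left) auto
    then show "k i = k' i" by linarith
  qed
  then show ?thesis unfolding disjoint_family_on_def by blast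
qed

text \<open>The infimum is a lower bound only if the energies are bounded below. Nonnegativity of
  \<open>f\<close> gives the bound 0, also where a non-integrable integrand produces the default
  value 0.\<close>

lemma M_eta_c_le:
  assumes "\<And>x \<xi>. 0 \<le> f x \<xi>" "u \<in> U_eta_c A p q \<eta> D"
  shows "M_eta_c A p q \<eta> f \<xi> D \<le> (LINT x:D|lebesgue. f x (\<xi> + u x))"
  unfolding M_eta_c_def
proof (rule cINF_lower)
  show "bdd_below ((\<lambda>u. LINT x:D|lebesgue. f x (\<xi> + u x)) ` U_eta_c A p q \<eta> D)"
    using assms(1) unfolding set_lebesgue_integral_def
    by (intro bdd_belowI2[of _ 0] integral_nonneg) (simp add: indicator_def)
qed fact

text \<open>Every tile misses \<open>cube R 0\<close> and is shifted by an integer vector, so all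
  tiles contribute the same \<open>f_per\<close> energy of \<open>u\<close>. Off the tiles the
  competitor is zero, and the growth bound at \<xi> is multiplied by the measure left
  uncovered.\<close>

lemma M_eta_c_tiling:
  fixes A :: "'n::finite \<Rightarrow> real^'d^'l" and f f_per :: "real^'n \<Rightarrow> real^'d \<Rightarrow> real"
    and r s R :: real
  assumes pq: "1 < p" "1 < q" "1 / p + 1 / q = 1" and \<eta>: "0 < \<eta>" and c0: "1 \<le> c0"
    and f: "f \<in> integrands c0 p"
    and per: "\<And>\<xi>. cube_periodic 1 (\<lambda>x. f_per x \<xi>)"
    and out: "\<And>x \<xi>. x \<notin> cube R 0 \<Longrightarrow> f x \<xi> = f_per x \<xi>"
    and s: "0 \<le> s" "s \<le> real m" and r: "0 < r" and J: "finite J"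
    and sub: "\<And>k. k \<in> J \<Longrightarrow> cube s (y0 + lattice_vec m k) \<subseteq> cube r y"
    and avoid: "\<And>k. k \<in> J \<Longrightarrow> cube s (y0 + lattice_vec m k) \<inter> cube R 0 = {}"
    and u: "u \<in> U_eta_c A p q \<eta> (cube s y0)"
  shows "M_eta_c A p q \<eta> f \<xi> (cube r y) \<le>
    card J * (LINT x:cube s y0|lebesgue. f_per x (\<xi> + u x)) +
    c0 * (1 + norm \<xi> powr p) * (r ^ CARD('n) - card J * s ^ CARD('n))"
proof -
  let ?D = "cube r y"
  define E where "E k = cube s (y0 + lattice_vec m k)" for k
  define w where "w = glue J E (\<lambda>k x. u (x - lattice_vec m k))"
  define U where "U = (\<Union>k\<in>J. E k)"
  have disj: "disjoint_family_on E J"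
    unfolding E_def by (rule disjoint_lattice_cubes[OF s(2)])
  have E: "E k \<in> lmeasurable" for k by (simp add: E_def lmeasurable_cube)
  have E_eq: "E k = {x. x - lattice_vec m k \<in> cube s y0}" for k
    by (simp add: E_def cube_translate)
  have U: "U \<in> lmeasurable" unfolding U_def using J E by (intro fmeasurable.finite_UN) auto
  have UD: "U \<subseteq> ?D" using sub by (auto simp: U_def E_def)
  have w: "w \<in> U_eta_c A p q \<eta> ?D"
    unfolding w_def
  proof (rule U_eta_c_glue[OF pq \<eta> lmeasurable_cube _ J disj E])
    show "(\<lambda>x. u (x - lattice_vec m k)) \<in> U_eta_c A p q \<eta> (E k)" for k
      unfolding E_eq by (rule U_eta_c_translate[OF u])
  qed (use r sub in \<open>auto simp: measure_cube E_def\<close>)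
  then have int_D: "set_integrable lebesgue ?D (\<lambda>x. f x (\<xi> + w x))"
    by (intro integrands_comp_integrable[OF f _ lmeasurable_cube pq(1) c0]) (simp add: U_eta_c_def)
  have int: "set_integrable lebesgue B (\<lambda>x. f x (\<xi> + w x))" if "B \<subseteq> ?D" "B \<in> sets lebesgue" for B
    by (rule set_integrable_subset[OF int_D that(2,1)])
  have f_w: "f x (\<xi> + w x) = f_per (x - lattice_vec m k) (\<xi> + u (x - lattice_vec m k))"
    if "k \<in> J" "x \<in> E k" for k x
  proof -
    have "f x (\<xi> + w x) = f_per x (\<xi> + u (x - lattice_vec m k))"
      using out[of x] avoid[OF that(1)] that
        glue_eq[where J = J and E = E and j = k and x = x and w = "\<lambda>k x. u (x - lattice_vec m k)", OF J disj that]
      by (auto simp: w_def E_def)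
    then show ?thesis
      using cube_periodic_int[OF per, of "x - lattice_vec m k" "\<lambda>i. int m * k i" "\<xi> + u (x - lattice_vec m k)"]
      by (simp add: lattice_vec_def)
  qed
  have "(LINT x:U|lebesgue. f x (\<xi> + w x)) = (\<Sum>k\<in>J. LINT x:E k|lebesgue. f x (\<xi> + w x))"
    unfolding U_def using sub E
    by (intro set_integral_finite_Union J disj int) (auto simp: E_def fmeasurableD)
  also have "\<dots> = (\<Sum>k\<in>J. LINT x:cube s y0|lebesgue. f_per x (\<xi> + u x))"
  proof (rule sum.cong[OF refl])
    fix k assume k: "k \<in> J"
    have "(LINT x:E k|lebesgue. f x (\<xi> + w x)) =
        (LINT x:E k|lebesgue. f_per (x - lattice_vec m k) (\<xi> + u (x - lattice_vec m k)))"
      using f_w[OF k] E by (intro set_lebesgue_integral_cong) (auto simp: fmeasurableD)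
    also have "\<dots> = (LINT x:cube s y0|lebesgue. f_per x (\<xi> + u x))"
      unfolding E_eq by (rule set_integral_translate(1))
    finally show "(LINT x:E k|lebesgue. f x (\<xi> + w x)) = (LINT x:cube s y0|lebesgue. f_per x (\<xi> + u x))" .
  qed
  also have "\<dots> = card J * (LINT x:cube s y0|lebesgue. f_per x (\<xi> + u x))" by simp
  finally have on_U: "(LINT x:U|lebesgue. f x (\<xi> + w x)) = \<dots>" .
  have DU: "?D - U \<in> lmeasurable" using U by (intro fmeasurable.Diff lmeasurable_cube) (auto simp: fmeasurableD)
  have "f x (\<xi> + w x) \<le> c0 * (1 + norm \<xi> powr p)" if "x \<in> ?D - U" for x
  proof -
    have "w x = 0" unfolding w_def using that by (intro glue_eq_0) (auto simp: U_def)
    then show ?thesis using f by (auto simp: integrands_def p_growth_def)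
  qed
  then have "(LINT x:?D - U|lebesgue. f x (\<xi> + w x)) \<le> (LINT x:?D - U|lebesgue. c0 * (1 + norm \<xi> powr p))"
    using DU by (intro set_integral_mono int absolutely_integrable_on_const) (auto simp: fmeasurableD)
  also have "\<dots> = c0 * (1 + norm \<xi> powr p) * measure lebesgue (?D - U)"
    using set_integral_const[of "?D - U" lebesgue "c0 * (1 + norm \<xi> powr p)"] fmeasurableD[OF DU] fmeasurableD2[OF DU]
    by (simp add: mult.commute)
  also have "measure lebesgue (?D - U) = r ^ CARD('n) - measure lebesgue U"
    using measurable_measure_Diff[OF lmeasurable_cube fmeasurableD[OF U] UD] r by (simp add: measure_cube)
  also have "measure lebesgue U = card J * s ^ CARD('n)"
    unfolding U_def using measure_finite_Union[OF J _ disj, of lebesgue] fmeasurableD2[OF E] fmeasurableD[OF E] s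
    by (simp add: image_subset_iff) (simp add: E_def measure_cube)
  finally have off_U: "(LINT x:?D - U|lebesgue. f x (\<xi> + w x)) \<le>
    c0 * (1 + norm \<xi> powr p) * (r ^ CARD('n) - card J * s ^ CARD('n))" .
  have "M_eta_c A p q \<eta> f \<xi> ?D \<le> (LINT x:?D|lebesgue. f x (\<xi> + w x))"
    using f by (intro M_eta_c_le w) (simp add: integrands_def)
  also have "\<dots> = (LINT x:U \<union> (?D - U)|lebesgue. f x (\<xi> + w x))"
    using UD by (simp add: Un_absorb1)
  also have "\<dots> = (LINT x:U|lebesgue. f x (\<xi> + w x)) + (LINT x:?D - U|lebesgue. f x (\<xi> + w x))"
    using U DU UD by (intro set_integral_Un int) (auto simp: fmeasurableD)
  finally show ?thesis using on_U off_U by linarith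
qed

section \<open>Counting the lattice cubes available in a large cube\<close>

lemma finite_lattice_points_near:
  fixes y :: "real^'n"
  assumes "0 < m"
  shows "finite {k. \<forall>i. \<bar>y $ i + real m * of_int (k i)\<bar> < c}"
proof -
  let ?T = "\<lambda>i. {\<lfloor>(- c - y $ i) / m\<rfloor>..\<lceil>(c - y $ i) / m\<rceil>}"
  have "k \<in> PiE UNIV ?T" if "\<forall>i. \<bar>y $ i + real m * of_int (k i)\<bar> < c" for k
  proof (rule PiE_I)
    fix i
    have "\<bar>y $ i + real m * of_int (k i)\<bar> < c" using that by blast
    then have "(- c - y $ i) / m \<le> of_int (k i)" "of_int (k i) \<le> (c - y $ i) / m"
      using assms by (simp_all add: field_simps abs_less_iff)
    then show "k i \<in> ?T i" by (simp add: floor_le_iff le_ceiling_iff)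
  qed simp
  then have "{k. \<forall>i. \<bar>y $ i + real m * of_int (k i)\<bar> < c} \<subseteq> PiE UNIV ?T" by blast
  then show ?thesis by (rule finite_subset) (simp add: finite_PiE)
qed

lemma cube_subset_cube:
  assumes "\<And>i. \<bar>y $ i - x $ i\<bar> \<le> (r - s) / 2"
  shows "cube s y \<subseteq> cube r x"
proof
  fix z assume "z \<in> cube s y"
  have "\<bar>z $ i - x $ i\<bar> < r / 2" for i
  proof -
    have "\<bar>z $ i - y $ i\<bar> < s / 2" using \<open>z \<in> cube s y\<close> by (simp add: cube_def)
    with assms[of i] show ?thesis by argo
  qed
  then show "z \<in> cube r x" by (simp add: cube_def)
qed

lemma cube_disjoint_cube:
  assumes "(R + s) / 2 \<le> \<bar>y $ i - x $ i\<bar>"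
  shows "cube s y \<inter> cube R x = {}"
proof -
  have False if "z \<in> cube s y" "z \<in> cube R x" for z
  proof -
    have "\<bar>z $ i - y $ i\<bar> < s / 2" "\<bar>z $ i - x $ i\<bar> < R / 2" using that by (auto simp: cube_def)
    with assms show False by argo
  qed
  then show ?thesis by blast
qed

text \<open>The order of the quantifiers is the point: \<open>K\<close> is the number of lattice
  cubes with centre close to the origin and serves all sides \<open>r\<close> and centres
  \<open>y\<close>. The two bounds on \<open>card J\<close> together determine the density of the
  tiles as \<open>r\<close> grows.\<close>

lemma many_lattice_cubes:
  fixes y0 :: "real^'n" and s R :: real
  assumes m: "0 < m"
  shows "\<exists>K. \<forall>r::real. \<forall>y. \<exists>J. finite J \<and>
    (\<forall>k\<in>J. cube s (y0 + lattice_vec m k) \<subseteq> cube r y \<and> cube s (y0 + lattice_vec m k) \<inter> cube R 0 = {}) \<and>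
    real (nat \<lfloor>(r - s) / m\<rfloor> ^ CARD('n)) - K \<le> card J \<and> card J \<le> nat \<lfloor>(r - s) / m\<rfloor> ^ CARD('n)"
proof -
  define B where "B = {k. \<forall>i. \<bar>y0 $ i + real m * of_int (k i)\<bar> < (R + s) / 2}"
  have B: "finite B" unfolding B_def by (rule finite_lattice_points_near[OF m])
  have "\<exists>J. finite J \<and>
    (\<forall>k\<in>J. cube s (y0 + lattice_vec m k) \<subseteq> cube r y \<and> cube s (y0 + lattice_vec m k) \<inter> cube R 0 = {}) \<and>
    real (nat \<lfloor>(r - s) / m\<rfloor> ^ CARD('n)) - card B \<le> card J \<and> card J \<le> nat \<lfloor>(r - s) / m\<rfloor> ^ CARD('n)"
    for r :: real and y :: "real^'n"
  proof -
    \<comment> \<open>In each coordinate the centres may fill an interval of length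
      \<open>r - s\<close>, which holds at least \<open>t\<close> points of spacing
      \<open>m\<close>; \<open>b i\<close> is the first admissible index. For \<open>r < s\<close>
      the conversion by \<open>nat\<close> makes \<open>t\<close> zero and the family empty.\<close>
    define t where "t = nat \<lfloor>(r - s) / m\<rfloor>"
    define b where "b i = \<lceil>(y $ i - y0 $ i - (r - s) / 2) / m\<rceil>" for i
    define g :: "('n \<Rightarrow> nat) \<Rightarrow> 'n \<Rightarrow> int" where "g j i = b i + int (j i)" for j i
    define I where "I = g ` PiE UNIV (\<lambda>_. {..<t})"
    have "inj g" by (auto simp: inj_def g_def fun_eq_iff)
    then have card_I: "card I = t ^ CARD('n)"
      unfolding I_def by (subst card_image) (auto simp: card_PiE intro: inj_on_subset)
    have I: "finite I" unfolding I_def by (intro finite_imageI finite_PiE) auto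
    show ?thesis
      unfolding t_def[symmetric]
    proof (intro exI[of _ "I - B"] conjI ballI)
      show "finite (I - B)" using I by simp
      show "card (I - B) \<le> t ^ CARD('n)" using I card_I by (metis card_mono Diff_subset)
      have "card I - card B \<le> card (I - B)" by (rule diff_card_le_card_Diff[OF B])
      then show "real (t ^ CARD('n)) - card B \<le> card (I - B)" unfolding card_I by linarith
      fix k assume k: "k \<in> I - B"
      then obtain j where j: "k = g j" "\<And>i. j i < t" by (auto simp: I_def PiE_iff)
      show "cube s (y0 + lattice_vec m k) \<subseteq> cube r y"
      proof (rule cube_subset_cube)
        fix i
        define a where "a = (y $ i - y0 $ i - (r - s) / 2) / m"
        \<comment> \<open>Rounding up to \<open>b i\<close> loses less than one index, and
          \<open>j i\<close> stops at \<open>t - 1\<close>, which leaves that one in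
          reserve.\<close>
        have a: "a \<le> b i" "b i < a + 1" unfolding a_def b_def by linarith+
        have "0 < t" using j(2)[of i] by simp
        then have "real t \<le> (r - s) / m" unfolding t_def by linarith
        moreover have "real (j i) + 1 \<le> real t" using j(2)[of i] by linarith
        ultimately have "real_of_int (k i) \<le> a + (r - s) / m" "a \<le> k i"
          using a by (auto simp: j(1) g_def)
        then have "real m * k i \<le> real m * (a + (r - s) / m)" "real m * a \<le> real m * k i"
          by (simp_all add: mult_left_mono)
        moreover have "real m * (a + (r - s) / m) = y $ i - y0 $ i + (r - s) / 2"
          "real m * a = y $ i - y0 $ i - (r - s) / 2"
          using m by (simp_all add: a_def field_simps)
        ultimately have "\<bar>y0 $ i + real m * k i - y $ i\<bar> \<le> (r - s) / 2" by argo
        then show "\<bar>(y0 + lattice_vec m k) $ i - y $ i\<bar> \<le> (r - s) / 2"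
          by (simp add: lattice_vec_def)
      qed
      from k obtain i where "(R + s) / 2 \<le> \<bar>y0 $ i + real m * of_int (k i)\<bar>"
        by (auto simp: B_def not_less)
      then show "cube s (y0 + lattice_vec m k) \<inter> cube R 0 = {}"
        by (intro cube_disjoint_cube[of _ _ _ i]) (simp add: lattice_vec_def)
    qed
  qed
  then show ?thesis by blast
qed

text \<open>The number of tiles divided by the volume of the large cube tends to the density of the
  lattice: discarding at most \<open>K\<close> tiles is negligible, uniformly in the centres
  \<open>c r\<close>, which are therefore arbitrary.\<close>

lemma M_eta_c_asymptotic_upper:
  fixes A :: "'n::finite \<Rightarrow> real^'d^'l" and f f_per :: "real^'n \<Rightarrow> real^'d \<Rightarrow> real"
    and s R a :: real and c :: "real \<Rightarrow> real^'n"
  assumes pq: "1 < p" "1 < q" "1 / p + 1 / q = 1" and \<eta>: "0 < \<eta>" and c0: "1 \<le> c0"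
    and f: "f \<in> integrands c0 p"
    and per: "\<And>\<xi>. cube_periodic 1 (\<lambda>x. f_per x \<xi>)"
    and out: "\<And>x \<xi>. x \<notin> cube R 0 \<Longrightarrow> f x \<xi> = f_per x \<xi>"
    and s: "0 < s" "s \<le> real m"
    and u: "u \<in> U_eta_c A p q \<eta> (cube s y0)"
    and a: "(LINT x:cube s y0|lebesgue. f_per x (\<xi> + u x)) / real m ^ CARD('n) +
      c0 * (1 + norm \<xi> powr p) * (1 - s ^ CARD('n) / real m ^ CARD('n)) < a"
  shows "\<forall>\<^sub>F r in at_top. M_eta_c A p q \<eta> f \<xi> (cube r (c r)) / r ^ CARD('n) < a"
proof -
  let ?N = "CARD('n)"
  define C where "C = c0 * (1 + norm \<xi> powr p)"
  define F where "F = (LINT x:cube s y0|lebesgue. f_per x (\<xi> + u x))"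
  define t where "t r = nat \<lfloor>(r - s) / m\<rfloor>" for r :: real
  have m: "0 < m" using s by (cases m) auto
  have "\<exists>K. \<forall>r. \<forall>y. \<exists>J. finite J \<and>
    (\<forall>k\<in>J. cube s (y0 + lattice_vec m k) \<subseteq> cube r y \<and> cube s (y0 + lattice_vec m k) \<inter> cube R 0 = {}) \<and>
    real (t r ^ ?N) - K \<le> card J \<and> card J \<le> t r ^ ?N"
    unfolding t_def by (rule many_lattice_cubes[OF m])
  then obtain K where "\<forall>r. \<exists>J. finite J \<and>
    (\<forall>k\<in>J. cube s (y0 + lattice_vec m k) \<subseteq> cube r (c r) \<and> cube s (y0 + lattice_vec m k) \<inter> cube R 0 = {}) \<and>
    real (t r ^ ?N) - K \<le> card J \<and> card J \<le> t r ^ ?N"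
    by meson
  from choice[OF this] obtain J where J: "\<forall>r. finite (J r) \<and>
    (\<forall>k\<in>J r. cube s (y0 + lattice_vec m k) \<subseteq> cube r (c r) \<and> cube s (y0 + lattice_vec m k) \<inter> cube R 0 = {}) \<and>
    real (t r ^ ?N) - K \<le> card (J r) \<and> card (J r) \<le> t r ^ ?N"
    by (rule exE)
  define n where "n r = card (J r)" for r
  have t_lim: "((\<lambda>r. t r / r) \<longlongrightarrow> 1 / m) at_top"
  proof (rule tendsto_sandwich)
    show "\<forall>\<^sub>F r in at_top. 1 / m - (s / m + 1) / r \<le> t r / r"
      using eventually_gt_at_top[of 0]
    proof eventually_elim
      case (elim r)
      \<comment> \<open>Rounding down costs at most 1; for \<open>r < s\<close> the left side is
        negative and \<open>t r\<close> is 0.\<close>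
      have "r / m - (s / m + 1) \<le> t r" unfolding t_def diff_divide_distrib by linarith
      then have "(r / m - (s / m + 1)) / r \<le> t r / r" using elim by (intro divide_right_mono) auto
      then show ?case using elim by (simp add: diff_divide_distrib)
    qed
    show "\<forall>\<^sub>F r in at_top. t r / r \<le> 1 / m"
      using eventually_gt_at_top[of s]
    proof eventually_elim
      case (elim r)
      then have "0 \<le> (r - s) / m" by simp
      then have "t r \<le> (r - s) / m" unfolding t_def by linarith
      also have "\<dots> \<le> r / m" using s by (intro divide_right_mono) auto
      finally have "t r / r \<le> r / m / r" using elim s by (intro divide_right_mono) auto
      then show ?case using elim s by simp
    qed
    have "((\<lambda>r::real. (s / m + 1) / r) \<longlongrightarrow> 0) at_top"
      by (intro tendsto_divide_0[OF tendsto_const] filterlim_at_top_imp_at_infinity filterlim_ident)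
    from tendsto_diff[OF tendsto_const this, of "1 / m"]
    show "((\<lambda>r. 1 / m - (s / m + 1) / r) \<longlongrightarrow> 1 / m) at_top" by simp
  qed simp
  have n_lim: "((\<lambda>r. n r / r ^ ?N) \<longlongrightarrow> (1 / m) ^ ?N) at_top"
  proof (rule tendsto_sandwich)
    show "\<forall>\<^sub>F r in at_top. (t r / r) ^ ?N - K / r ^ ?N \<le> n r / r ^ ?N"
      using eventually_gt_at_top[of 0]
    proof eventually_elim
      case (elim r)
      then show ?case
        using divide_right_mono[of "real (t r ^ ?N) - K" "card (J r)" "r ^ ?N"] J
        by (simp add: n_def power_divide diff_divide_distrib)
    qed
    show "\<forall>\<^sub>F r in at_top. n r / r ^ ?N \<le> (t r / r) ^ ?N"
      using eventually_gt_at_top[of 0]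
    proof eventually_elim
      case (elim r)
      have "real (n r) \<le> real (t r ^ ?N)" unfolding n_def using J by (intro of_nat_mono) blast
      then show ?case
        using elim by (simp add: power_divide divide_right_mono)
    qed
    have "filterlim (\<lambda>r::real. r ^ ?N) at_top at_top"
      by (intro filterlim_pow_at_top filterlim_ident) simp
    then have "((\<lambda>r. K / r ^ ?N) \<longlongrightarrow> 0) at_top"
      by (intro tendsto_divide_0[OF tendsto_const] filterlim_at_top_imp_at_infinity)
    from tendsto_diff[OF tendsto_power[OF t_lim] this, of ?N]
    show "((\<lambda>r. (t r / r) ^ ?N - K / r ^ ?N) \<longlongrightarrow> (1 / m) ^ ?N) at_top" by simp
    show "((\<lambda>r. (t r / r) ^ ?N) \<longlongrightarrow> (1 / m) ^ ?N) at_top"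
      by (rule tendsto_power[OF t_lim])
  qed
  \<comment> \<open>This is the bound of \<open>M_eta_c_tiling\<close> divided by
    \<open>r ^ ?N\<close> and regrouped so that \<open>r\<close> enters only through the density of
    the tiles.\<close>
  have "((\<lambda>r. n r / r ^ ?N * (F - C * s ^ ?N) + C) \<longlongrightarrow> (1 / m) ^ ?N * (F - C * s ^ ?N) + C) at_top"
    by (intro tendsto_intros n_lim)
  moreover have "(1 / m) ^ ?N * (F - C * s ^ ?N) + C < a"
    using a unfolding F_def[symmetric] C_def[symmetric] by (simp add: power_divide algebra_simps diff_divide_distrib)
  ultimately have "\<forall>\<^sub>F r in at_top. n r / r ^ ?N * (F - C * s ^ ?N) + C < a"
    by (rule order_tendstoD(2))
  with eventually_gt_at_top[of 0] show ?thesis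
  proof eventually_elim
    case (elim r)
    have "M_eta_c A p q \<eta> f \<xi> (cube r (c r)) \<le> n r * F + C * (r ^ ?N - n r * s ^ ?N)"
      unfolding n_def F_def C_def
      by (rule M_eta_c_tiling[OF pq \<eta> c0 f per out _ s(2) _ _ _ _ u]) (use s elim J in auto)
    then have "M_eta_c A p q \<eta> f \<xi> (cube r (c r)) / r ^ ?N \<le> (n r * F + C * (r ^ ?N - n r * s ^ ?N)) / r ^ ?N"
      using elim by (intro divide_right_mono) auto
    also have "\<dots> = n r / r ^ ?N * (F - C * s ^ ?N) + C"
      using elim by (simp add: field_simps)
    finally show ?case using elim by linarith
  qed
qed

section \<open>Existence of the limit\<close>

text \<open>A single \<open>L\<close> serves all choices of centres \<open>c\<close>, since neither
  the set \<open>S\<close> in the proof nor the lower bound refers to them.\<close>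

lemma M_eta_c_limit:
  fixes A :: "'n::finite \<Rightarrow> real^'d^'l" and f f_per :: "real^'n \<Rightarrow> real^'d \<Rightarrow> real"
    and R :: real
  assumes pq: "1 < p" "1 < q" "1 / p + 1 / q = 1" and \<eta>: "0 < \<eta>" and c0: "1 \<le> c0"
    and f: "f \<in> integrands c0 p" and f_per: "f_per \<in> integrands c0 p"
    and le: "\<And>x \<xi>. f_per x \<xi> \<le> f x \<xi>"
    and per: "\<And>\<xi>. cube_periodic 1 (\<lambda>x. f_per x \<xi>)"
    and out: "\<And>x \<xi>. x \<notin> cube R 0 \<Longrightarrow> f x \<xi> = f_per x \<xi>"
  shows "\<exists>L. \<forall>c. ((\<lambda>r. M_eta_c A p q \<eta> f \<xi> (cube r (c r)) / r ^ CARD('n)) \<longlongrightarrow> L) at_top"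
proof -
  let ?N = "CARD('n)"
  define C where "C = c0 * (1 + norm \<xi> powr p)"
  define F where "F s y u = (LINT x:cube s y|lebesgue. f_per x (\<xi> + u x))" for s y u
  \<comment> \<open>Each element is the asymptotic bound obtained by tiling with \<open>u\<close> at
    spacing \<open>m\<close>: energy per unit volume plus \<open>C\<close> times the uncovered
    fraction.\<close>
  define S where "S = {F s y u / real m ^ ?N + C * (1 - s ^ ?N / real m ^ ?N) | s m y u.
    0 < s \<and> s \<le> real m \<and> u \<in> U_eta_c A p q \<eta> (cube s y)}"
  have S_I: "F s y u / real m ^ ?N + C * (1 - s ^ ?N / real m ^ ?N) \<in> S"
    if "0 < s" "s \<le> real m" "u \<in> U_eta_c A p q \<eta> (cube s y)" for s m y u
    unfolding S_def using that by blast
  define L where "L = Inf S"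
  have "0 \<le> a" if aS: "a \<in> S" for a
  proof -
    obtain s m y u where a: "a = F s y u / real m ^ ?N + C * (1 - s ^ ?N / real m ^ ?N)"
      and s: "0 < s" "s \<le> real m" using aS by (auto simp: S_def)
    have "0 \<le> F s y u"
      using f_per unfolding F_def set_lebesgue_integral_def
      by (intro Bochner_Integration.integral_nonneg) (simp add: integrands_def indicator_def)
    moreover have "s ^ ?N \<le> real m ^ ?N" using s by (intro power_mono) auto
    moreover have "0 \<le> C" using c0 by (simp add: C_def)
    ultimately show ?thesis unfolding a using s by (simp add: divide_le_eq_1)
  qed
  then have S_bdd: "bdd_below S" by (rule bdd_belowI)
  have "U_eta_c A p q \<eta> (cube 1 0) \<noteq> {}"
    by (rule U_eta_c_cube_nonempty[OF pq \<eta>]) simp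
  then obtain u0 where "u0 \<in> U_eta_c A p q \<eta> (cube 1 0)" by blast
  then have S_ne: "S \<noteq> {}" using S_I[of 1 1 u0 0] by auto
  \<comment> \<open>This is the smallest integer spacing allowed for tiles of side \<open>r\<close>.
    Its ratio to \<open>r\<close> tends to 1, so the uncovered fraction disappears in the
    limit.\<close>
  define m where "m r = nat \<lceil>r\<rceil>" for r :: real
  have lower: "(m r / r) ^ ?N * (L - C) + C \<le> M_eta_c A p q \<eta> f \<xi> (cube r y) / r ^ ?N"
    if r: "0 < r" for r y
  proof -
    have m: "r \<le> m r" "0 < m r" using r unfolding m_def by linarith+
    have "real (m r) ^ ?N * (L - C) + C * r ^ ?N \<le> M_eta_c A p q \<eta> f \<xi> (cube r y)"
      unfolding M_eta_c_def
    proof (rule cINF_greatest[OF U_eta_c_cube_nonempty[OF pq \<eta> r]])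
      fix u assume u: "u \<in> U_eta_c A p q \<eta> (cube r y)"
      \<comment> \<open>Every competitor on \<open>cube r y\<close> itself yields an element of
        \<open>S\<close>. Clearing denominators bounds its \<open>f_per\<close> energy from below,
        and its \<open>f\<close> energy is at least as large.\<close>
      have "L \<le> F r y u / real (m r) ^ ?N + C * (1 - r ^ ?N / real (m r) ^ ?N)"
        unfolding L_def using r m u by (intro cInf_lower[OF _ S_bdd]) (rule S_I)
      then have "real (m r) ^ ?N * (L - C) + C * r ^ ?N \<le> F r y u"
        using m(2) by (simp add: field_simps)
      also have "\<dots> \<le> (LINT x:cube r y|lebesgue. f x (\<xi> + u x))"
        unfolding F_def
      proof (rule set_integral_mono)
        have "Lp p (cube r y) u" using u by (simp add: U_eta_c_def)
        then show "set_integrable lebesgue (cube r y) (\<lambda>x. f_per x (\<xi> + u x))"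
          "set_integrable lebesgue (cube r y) (\<lambda>x. f x (\<xi> + u x))"
          using f f_per by (auto intro: integrands_comp_integrable lmeasurable_cube pq c0)
      qed (rule le)
      finally show "real (m r) ^ ?N * (L - C) + C * r ^ ?N \<le> (LINT x:cube r y|lebesgue. f x (\<xi> + u x))" .
    qed
    then have "(real (m r) ^ ?N * (L - C) + C * r ^ ?N) / r ^ ?N \<le> M_eta_c A p q \<eta> f \<xi> (cube r y) / r ^ ?N"
      using r by (intro divide_right_mono) auto
    then show ?thesis using r by (simp add: add_divide_distrib power_divide)
  qed
  have "((\<lambda>r. m r / r) \<longlongrightarrow> 1) at_top"
  proof (rule tendsto_sandwich)
    have m_bounds: "r \<le> m r" "m r \<le> r + 1" if "0 < r" for r :: real
      using that unfolding m_def by linarith+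
    show "\<forall>\<^sub>F r in at_top. 1 \<le> m r / r"
      using eventually_gt_at_top[of 0] by eventually_elim (use m_bounds in \<open>simp add: le_divide_eq\<close>)
    show "\<forall>\<^sub>F r in at_top. m r / r \<le> 1 + 1 / r"
      using eventually_gt_at_top[of 0]
      by eventually_elim (use m_bounds in \<open>simp add: divide_le_eq distrib_right\<close>)
    have "((\<lambda>r::real. 1 / r) \<longlongrightarrow> 0) at_top"
      by (intro tendsto_divide_0[OF tendsto_const] filterlim_at_top_imp_at_infinity filterlim_ident)
    from tendsto_add[OF tendsto_const this, of 1]
    show "((\<lambda>r::real. 1 + 1 / r) \<longlongrightarrow> 1) at_top" by simp
  qed simp
  then have "((\<lambda>r. (m r / r) ^ ?N * (L - C) + C) \<longlongrightarrow> 1 ^ ?N * (L - C) + C) at_top"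
    by (intro tendsto_intros)
  then have lower_lim: "((\<lambda>r. (m r / r) ^ ?N * (L - C) + C) \<longlongrightarrow> L) at_top" by simp
  have "((\<lambda>r. M_eta_c A p q \<eta> f \<xi> (cube r (c r)) / r ^ ?N) \<longlongrightarrow> L) at_top" for c
  proof (rule order_tendstoI)
    fix a assume "a < L"
    from order_tendstoD(1)[OF lower_lim this] eventually_gt_at_top[of 0]
    show "\<forall>\<^sub>F r in at_top. a < M_eta_c A p q \<eta> f \<xi> (cube r (c r)) / r ^ ?N"
    proof eventually_elim
      case (elim r)
      then show ?case using lower[of r "c r"] by linarith
    qed
  next
    fix a assume "L < a"
    \<comment> \<open>An element of \<open>S\<close> below \<open>a\<close> provides a competitor
      and a spacing whose tilings keep the quotient below \<open>a\<close> for all large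
      \<open>r\<close>.\<close>
    then obtain b where "b \<in> S" "b < a"
      unfolding L_def using cInf_lessD[OF S_ne] by blast
    then obtain s m y u where s: "0 < s" "s \<le> real m" and u: "u \<in> U_eta_c A p q \<eta> (cube s y)"
      and "F s y u / real m ^ ?N + C * (1 - s ^ ?N / real m ^ ?N) < a"
      by (auto simp: S_def)
    then have a: "(LINT x:cube s y|lebesgue. f_per x (\<xi> + u x)) / real m ^ ?N +
      c0 * (1 + norm \<xi> powr p) * (1 - s ^ ?N / real m ^ ?N) < a"
      by (simp only: F_def C_def)
    show "\<forall>\<^sub>F r in at_top. M_eta_c A p q \<eta> f \<xi> (cube r (c r)) / r ^ ?N < a"
      by (rule M_eta_c_asymptotic_upper[OF pq \<eta> c0 f per out s u a])
  qed
  then show ?thesis by blast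
qed

theorem proposition7p2:
  fixes A :: "'n::finite \<Rightarrow> real^'d^'l"
    and p q c0 c1 c1_hat :: real
    and f f_per f_comp :: "real^'n \<Rightarrow> real^'d \<Rightarrow> real"
  assumes "1 < p" and "1 < q" and "1 / p + 1 / q = 1"
    and "constant_rank A"
    and "1 \<le> c0" and "1 \<le> c1_hat" and "c1_hat \<le> c1"
    and "span (wave_cone A) = UNIV \<Longrightarrow>
      (\<forall>g. A_quasiconvex A g \<and> (\<forall>\<xi>. 0 \<le> g \<xi>) \<and> p_growth c0 p g \<longrightarrow> p_lipschitz c1_hat p g)"
    and "f \<in> integrands_Lip c0 c1 p"
    and "\<And>x \<xi>. f x \<xi> = f_per x \<xi> + f_comp x \<xi>"
    and "f_per \<in> integrands_Lip c0 c1 p"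
    and "f_comp \<in> integrands_Lip_upper c0 c1 p"
    and "\<And>\<xi>. cube_periodic 1 (\<lambda>x. f_per x \<xi>)"
    and "\<exists>R>0. \<forall>x \<xi>. x \<notin> cube R 0 \<longrightarrow> f_comp x \<xi> = 0"
  shows "\<forall>\<xi>. (\<forall>j. \<xi> $ j \<in> \<rat>) \<longrightarrow> (\<forall>k::nat. k \<ge> 1 \<longrightarrow>
    (\<exists>L::real. \<forall>x::real^'n.
      ((\<lambda>r. M_eta_c A p q (1 / real k) f \<xi> (cube r (r *\<^sub>R x)) / r ^ CARD('n)) \<longlongrightarrow> L) at_top))"
proof (intro allI impI)
  fix \<xi> :: "real^'d" and k :: nat
  assume k: "1 \<le> k"
  obtain R where R: "\<And>x \<xi>. x \<notin> cube R 0 \<Longrightarrow> f_comp x \<xi> = 0"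
    using assms(14) by blast
  have "\<exists>L. \<forall>c. ((\<lambda>r. M_eta_c A p q (1 / real k) f \<xi> (cube r (c r)) / r ^ CARD('n)) \<longlongrightarrow> L) at_top"
  proof (rule M_eta_c_limit[OF assms(1-3) _ assms(5) _ _ _ assms(13)])
    show "f \<in> integrands c0 p" "f_per \<in> integrands c0 p"
      using assms(9,11) by (auto simp: integrands_Lip_def)
    \<comment> \<open>The perturbation is nonnegative.\<close>
    show "f_per x \<xi> \<le> f x \<xi>" for x \<xi>
      using assms(10)[of x \<xi>] assms(12) by (simp add: integrands_Lip_upper_def)
    show "f x \<xi> = f_per x \<xi>" if "x \<notin> cube R 0" for x \<xi>
      using assms(10)[of x \<xi>] R[OF that, of \<xi>] by simp
  qed (use k in simp)
  then obtain L where L: "\<And>c. ((\<lambda>r. M_eta_c A p q (1 / real k) f \<xi> (cube r (c r)) / r ^ CARD('n)) \<longlongrightarrow> L) at_top"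
    by blast
  show "\<exists>L. \<forall>x. ((\<lambda>r. M_eta_c A p q (1 / real k) f \<xi> (cube r (r *\<^sub>R x)) / r ^ CARD('n)) \<longlongrightarrow> L) at_top"
    \<comment> \<open>The centres \<open>r *\<^sub>R x\<close> are one choice of \<open>c\<close>,
      and \<open>L\<close> was fixed before that choice.\<close>
    by (intro exI[of _ L] allI L)
qed

end
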